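(* Let $S$ be one of the spaces $l^p_{(\beta_i)}$ ($1\le p<\infty$), $l^\infty_{(\beta_i)}$, $\mathbb R^{\mathbb N}$, let $\mu$ be a Borel probability measure on $(S,\mathcal B(S))$, and let $0<\alpha<2$. If $1<\alpha<2$, assume in addition that for each $i\in\mathbb N$ the conditional distribution $\mu(\cdot\,|\,\sigma_{i^c})$ has a locally bounded density in the following sense: there is a $\sigma_{i^c}$-measurable function $0\le\rho(\cdot\,|\,\sigma_{i^c})$ on $\mathbb R$ with $\mu(dy\,|\,\sigma_{i^c})=\rho(y\,|\,\sigma_{i^c})\,dy$, $\mu$-a.e., and for every compact $K\subset\mathbb R$ there is a constant $L_i<\infty$ (which may depend on $i$) with $\operatorname{ess\,sup}_{y\in K}\rho(y\,|\,\sigma_{i^c})\le L_i$, $\mu$-a.e. (the essential supremum being with respect to Lebesgue measure). Then the symmetric non-local form $\mathcal E_{(\alpha)}=\sum_{i\in\mathbb N}\mathcal E^{(i)}_{(\alpha)}$ is (i) well-defined on $\mathcal FC_0^\infty$; (ii) Markovian; (iii) closable in $L^2(S;\mu)$.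
   Context: **State spaces.** For $p\in[1,\infty)$ and weights $\beta_i>0$, $i\in\mathbb N$, $l^p_{(\beta_i)}=\{\mathbf x=(x_1,x_2,\dots)\in\mathbb R^{\mathbb N}:\|\mathbf x\|=(\sum_{i}\beta_i|x_i|^p)^{1/p}<\infty\}$; $l^\infty_{(\beta_i)}=\{\mathbf x\in\mathbb R^{\mathbb N}:\|\mathbf x\|=\sup_i\beta_i|x_i|<\infty\}$; $\mathbb R^{\mathbb N}$ carries the product metric $d(\mathbf x,\mathbf x')=\sum_{k\ge1}2^{-k}\frac{\|\mathbf x-\mathbf x'\|_k}{\|\mathbf x-\mathbf x'\|_k+1}$ with $\|\mathbf x\|_k=(\sum_{i=1}^k x_i^2)^{1/2}$. $\mathcal B(S)$ is the Borel $\sigma$-field of $S$. **Conditional distributions.** For $i\in\mathbb N$, $\sigma_{i^c}$ is the sub-$\sigma$-field of $\mathcal B(S)$ generated by the sets $\{\mathbf x\in S: x_{j_1}\in B_1,\dots,x_{j_n}\in B_n\}$ with $n\in\mathbb N$, $j_k\ne i$, $B_k$ Borel in $\mathbb R$. $\mu(\cdot\,|\,\sigma_{i^c})$ is the conditional probability of the $i$-th coordinate, i.e. the $\sigma_{i^c}$-measurable function with values in the probability distributions on $\mathbb R$ characterized by $\mu(\{\mathbf x:x_i\in A\}\cap B)=\int_B\mu(A\,|\,\sigma_{i^c})\,\mu(d\mathbf x)$ for all Borel $A\subset\mathbb R$ and $B\in\sigma_{i^c}$. **Function spaces.** $L^2(S;\mu)$ is the usual real $L^2$ space. $\mathcal FC_0^\infty\subset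 L^2(S;\mu)$ is the space of $\mu$-equivalence classes of functions $f\in C_0^\infty(\mathbb R^n\to\mathbb R)$, $n\in\mathbb N$, where such $f$ is regarded as the function $\mathbf x\mapsto f(x_1,\dots,x_n)$ on $S$. **The forms.** For $\mathbf x\in S$ write $\mathbf x\setminus x_i=(x_1,\dots,x_{i-1},x_{i+1},\dots)$. For $y_i\neq y_i'$ in $\mathbb R$, $$\Phi_\alpha(u,v;y_i,y_i',\mathbf x\setminus x_i)=\frac{1}{|y_i-y_i'|^{\alpha+1}}\{u(x_1,\dots,x_{i-1},y_i,x_{i+1},\dots)-u(x_1,\dots,x_{i-1},y_i',x_{i+1},\dots)\}\{v(x_1,\dots,x_{i-1},y_i,x_{i+1},\dots)-v(x_1,\dots,x_{i-1},y_i',x_{i+1},\dots)\},$$ $$\mathcal E^{(i)}_{(\alpha)}(u,v)=\int_S\Big\{\int_{\mathbb R}I_{\{y_i\ne x_i\}}(y_i)\,\Phi_\alpha(u,v;y_i,x_i,\mathbf x\setminus x_i)\,\mu(dy_i\,|\,\sigma_{i^c})\Big\}\mu(d\mathbf x),\qquad \mathcal E_{(\alpha)}(u,v)=\sum_{i\in\mathbb N}\mathcal E^{(i)}_{(\alpha)}(u,v).$$ **Meaning of the assertions.** *Well-defined on $\mathcal FC_0^\infty$*: $\mathcal E_{(\alpha)}(u,u)=0$ whenever $u\in\mathcal FC_0^\infty$ and $u=0$ $\mu$-a.e. (so the value does not depend on the representatives), and $\mathcal E_{(\alpha)}(u,v)\in\mathbb R$ for all $u,v\in\mathcal FC_0^\infty$.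 *Markovian*: for every $\epsilon>0$ there is a function $\varphi_\epsilon:\mathbb R\to\mathbb R$ with $\varphi_\epsilon(t)=t$ for $t\in[0,1]$, $-\epsilon\le\varphi_\epsilon\le1+\epsilon$, $0\le\varphi_\epsilon(t')-\varphi_\epsilon(t)\le t'-t$ for $t<t'$, such that for all $u\in\mathcal FC_0^\infty$ one has $\varphi_\epsilon(u)\in\mathcal FC_0^\infty$ and $\mathcal E_{(\alpha)}(\varphi_\epsilon(u),\varphi_\epsilon(u))\le\mathcal E_{(\alpha)}(u,u)$. *Closable in $L^2(S;\mu)$*: if $u_n\in\mathcal FC_0^\infty$, $\|u_n\|_{L^2(S;\mu)}\to0$ and $\mathcal E_{(\alpha)}(u_n-u_m,u_n-u_m)\to0$ as $n,m\to\infty$, then $\mathcal E_{(\alpha)}(u_n,u_n)\to0$. *)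

theory Defs
  imports "HOL-Probability.Probability"
begin

text \<open>Coordinates are numbered from 0, so \<open>x i\<close> is the coordinate written $x_{i+1}$ when
  sequences are numbered from 1.\<close>

type_synonym seq = "nat \<Rightarrow> real"

section \<open>State spaces\<close>

definition lp_space :: "real \<Rightarrow> (nat \<Rightarrow> real) \<Rightarrow> seq set" where
  "lp_space p \<beta> = {x. summable (\<lambda>i. \<beta> i * \<bar>x i\<bar> powr p)}"

definition lp_norm :: "real \<Rightarrow> (nat \<Rightarrow> real) \<Rightarrow> seq \<Rightarrow> real" where
  "lp_norm p \<beta> x = (\<Sum>i. \<beta> i * \<bar>x i\<bar> powr p) powr (1 / p)"

definition linf_space :: "(nat \<Rightarrow> real) \<Rightarrow> seq set" where
  "linf_space \<beta> = {x. bdd_above (range (\<lambda>i. \<beta> i * \<bar>x i\<bar>))}"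

text \<open>The value outside the space is irrelevant, but \<open>Metric_space\<close> requires the distance to be
  nonnegative also outside the carrier, and the supremum of an unbounded set is unspecified.\<close>

definition linf_norm :: "(nat \<Rightarrow> real) \<Rightarrow> seq \<Rightarrow> real" where
  "linf_norm \<beta> x = (if x \<in> linf_space \<beta> then (SUP i. \<beta> i * \<bar>x i\<bar>) else 0)"

text \<open>The summand with index \<open>k\<close> is the one for the seminorm of the first \<open>k + 1\<close> coordinates.\<close>

definition product_dist :: "seq \<Rightarrow> seq \<Rightarrow> real" where
  "product_dist x y =
     (\<Sum>k. (1/2) ^ Suc k *
        (L2_set (\<lambda>i. x i - y i) {..k} / (L2_set (\<lambda>i. x i - y i) {..k} + 1)))"

definition state_space :: "seq set \<Rightarrow> (seq \<Rightarrow> seq \<Rightarrow> real) \<Rightarrow> bool" where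
  "state_space S d \<longleftrightarrow>
     (\<exists>p \<beta>. 1 \<le> p \<and> (\<forall>i. 0 < \<beta> i) \<and> S = lp_space p \<beta> \<and>
            d = (\<lambda>x y. lp_norm p \<beta> (\<lambda>i. x i - y i))) \<or>
     (\<exists>\<beta>. (\<forall>i. 0 < \<beta> i) \<and> S = linf_space \<beta> \<and>
            d = (\<lambda>x y. linf_norm \<beta> (\<lambda>i. x i - y i))) \<or>
     (S = UNIV \<and> d = product_dist)"

text \<open>The Borel field is that of the metric topology; on the nonseparable weighted
  \<open>l\<^sup>\<infinity>\<close> spaces it may be larger than the one generated by the coordinates.\<close>

definition metric_borel :: "seq set \<Rightarrow> (seq \<Rightarrow> seq \<Rightarrow> real) \<Rightarrow> seq measure" where
  "metric_borel S d = sigma S {U. openin (Metric_space.mtopology S d) U}"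

section \<open>Conditional distributions of single coordinates\<close>

definition sigma_off :: "seq set \<Rightarrow> nat \<Rightarrow> seq measure" where
  "sigma_off S i =
     sigma S {{x \<in> S. \<forall>j\<in>J. x j \<in> B j} | J B. finite J \<and> i \<notin> J \<and> (\<forall>j\<in>J. B j \<in> sets borel)}"

text \<open>\<open>\<kappa>\<close> is a version of the conditional distribution of the \<open>i\<close>-th coordinate given all
  the other coordinates.\<close>

definition cond_dist :: "seq set \<Rightarrow> seq measure \<Rightarrow> nat \<Rightarrow> (seq \<Rightarrow> real measure) \<Rightarrow> bool" where
  "cond_dist S \<mu> i \<kappa> \<longleftrightarrow>
     \<kappa> \<in> measurable (sigma_off S i) (prob_algebra borel) \<and>
     (\<forall>A\<in>sets borel. \<forall>B\<in>sets (sigma_off S i).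
        emeasure \<mu> ({x \<in> S. x i \<in> A} \<inter> B) = (\<integral>\<^sup>+x\<in>B. emeasure (\<kappa> x) A \<partial>\<mu>))"

text \<open>Only separate measurability of the density \<open>\<rho>\<close> is required, which is implied by joint
  measurability.\<close>

definition locally_bounded_density ::
    "seq set \<Rightarrow> seq measure \<Rightarrow> nat \<Rightarrow> (seq \<Rightarrow> real measure) \<Rightarrow> bool" where
  "locally_bounded_density S \<mu> i \<kappa> \<longleftrightarrow>
     (\<exists>\<rho> :: seq \<Rightarrow> real \<Rightarrow> real.
        (\<forall>x\<in>S. \<forall>y. 0 \<le> \<rho> x y) \<and>
        (\<forall>y. (\<lambda>x. \<rho> x y) \<in> borel_measurable (sigma_off S i)) \<and>
        (\<forall>x\<in>S. \<rho> x \<in> borel_measurable borel) \<and>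
        (AE x in \<mu>. \<kappa> x = density lborel (\<lambda>y. ennreal (\<rho> x y))) \<and>
        (\<forall>K. compact K \<longrightarrow>
           (\<exists>L::real. AE x in \<mu>. esssup (restrict_space lborel K) (\<lambda>y. ereal (\<rho> x y)) \<le> ereal L)))"

section \<open>Smooth cylinder functions\<close>

text \<open>A function on $R^n$ is represented by a function of sequences that depends only on the
  first \<open>n\<close> coordinates. Such a function is continuous for the product topology iff the
  corresponding function on $R^n$ is continuous.\<close>

definition depends_on_first :: "nat \<Rightarrow> (seq \<Rightarrow> real) \<Rightarrow> bool" where
  "depends_on_first n f \<longleftrightarrow> (\<forall>x y. (\<forall>i<n. x i = y i) \<longrightarrow> f x = f y)"

definition partial_deriv :: "nat \<Rightarrow> (seq \<Rightarrow> real) \<Rightarrow> seq \<Rightarrow> real" where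
  "partial_deriv j f x = deriv (\<lambda>t. f (x(j := t))) (x j)"

primrec C_k :: "nat \<Rightarrow> nat \<Rightarrow> (seq \<Rightarrow> real) \<Rightarrow> bool" where
  "C_k n 0 f \<longleftrightarrow> continuous_on UNIV f"
| "C_k n (Suc k) f \<longleftrightarrow>
     continuous_on UNIV f \<and>
     (\<forall>j<n. (\<forall>x. (\<lambda>t. f (x(j := t))) differentiable (at (x j))) \<and> C_k n k (partial_deriv j f))"

text \<open>The condition on \<open>R\<close> says that the support in $R^n$ is bounded, i.e. has compact closure.\<close>

definition C0_infinity :: "nat \<Rightarrow> (seq \<Rightarrow> real) set" where
  "C0_infinity n =
     {f. depends_on_first n f \<and> (\<forall>k. C_k n k f) \<and>
         (\<exists>R. \<forall>x. f x \<noteq> 0 \<longrightarrow> (\<forall>i<n. \<bar>x i\<bar> \<le> R))}"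

text \<open>The elements are representatives; equality of the represented classes is equality almost
  everywhere.\<close>

definition FC :: "(seq \<Rightarrow> real) set" where
  "FC = (\<Union>n\<in>{1..}. C0_infinity n)"

section \<open>The forms\<close>

definition Phi :: "real \<Rightarrow> nat \<Rightarrow> (seq \<Rightarrow> real) \<Rightarrow> (seq \<Rightarrow> real) \<Rightarrow> real \<Rightarrow> real \<Rightarrow> seq \<Rightarrow> real" where
  "Phi \<alpha> i u v y y' x =
     1 / \<bar>y - y'\<bar> powr (\<alpha> + 1) *
       ((u (x(i := y)) - u (x(i := y'))) * (v (x(i := y)) - v (x(i := y'))))"

definition inner_integrand ::
    "real \<Rightarrow> nat \<Rightarrow> (seq \<Rightarrow> real) \<Rightarrow> (seq \<Rightarrow> real) \<Rightarrow> seq \<Rightarrow> real \<Rightarrow> real" where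
  "inner_integrand \<alpha> i u v x y = indicator {y. y \<noteq> x i} y * Phi \<alpha> i u v y (x i) x"

definition form_i ::
    "real \<Rightarrow> seq measure \<Rightarrow> (seq \<Rightarrow> real measure) \<Rightarrow> nat \<Rightarrow> (seq \<Rightarrow> real) \<Rightarrow> (seq \<Rightarrow> real) \<Rightarrow> real" where
  "form_i \<alpha> \<mu> \<kappa> i u v = (\<integral>x. (\<integral>y. inner_integrand \<alpha> i u v x y \<partial>\<kappa> x) \<partial>\<mu>)"

definition form ::
    "real \<Rightarrow> seq measure \<Rightarrow> (nat \<Rightarrow> seq \<Rightarrow> real measure) \<Rightarrow> (seq \<Rightarrow> real) \<Rightarrow> (seq \<Rightarrow> real) \<Rightarrow> real" where
  "form \<alpha> \<mu> \<kappa> u v = (\<Sum>i. form_i \<alpha> \<mu> (\<kappa> i) i u v)"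

text \<open>Integrals and series that do not converge have a default value, so \<open>form\<close> being a real
  number carries no information by itself. The following states that all the integrals and
  the series defining \<open>form \<alpha> \<mu> \<kappa> u v\<close> exist.\<close>

definition form_exists ::
    "real \<Rightarrow> seq measure \<Rightarrow> (nat \<Rightarrow> seq \<Rightarrow> real measure) \<Rightarrow> (seq \<Rightarrow> real) \<Rightarrow> (seq \<Rightarrow> real) \<Rightarrow> bool" where
  "form_exists \<alpha> \<mu> \<kappa> u v \<longleftrightarrow>
     (\<forall>i. (AE x in \<mu>. integrable (\<kappa> i x) (inner_integrand \<alpha> i u v x)) \<and>
          integrable \<mu> (\<lambda>x. \<integral>y. inner_integrand \<alpha> i u v x y \<partial>\<kappa> i x)) \<and>
     summable (\<lambda>i. form_i \<alpha> \<mu> (\<kappa> i) i u v)"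

text \<open>The second clause is the independence of representatives; it is stated separately because
  \<open>FC\<close> is not closed under differences.\<close>

definition well_defined_on_FC ::
    "real \<Rightarrow> seq measure \<Rightarrow> (nat \<Rightarrow> seq \<Rightarrow> real measure) \<Rightarrow> bool" where
  "well_defined_on_FC \<alpha> \<mu> \<kappa> \<longleftrightarrow>
     (\<forall>u\<in>FC. (AE x in \<mu>. u x = 0) \<longrightarrow> form \<alpha> \<mu> \<kappa> u u = 0) \<and>
     (\<forall>u\<in>FC. \<forall>u'\<in>FC. \<forall>v\<in>FC. \<forall>v'\<in>FC.
        (AE x in \<mu>. u x = u' x) \<longrightarrow> (AE x in \<mu>. v x = v' x) \<longrightarrow>
          form \<alpha> \<mu> \<kappa> u v = form \<alpha> \<mu> \<kappa> u' v') \<and>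
     (\<forall>u\<in>FC. \<forall>v\<in>FC. form_exists \<alpha> \<mu> \<kappa> u v)"

definition markovian :: "((seq \<Rightarrow> real) \<Rightarrow> (seq \<Rightarrow> real) \<Rightarrow> real) \<Rightarrow> bool" where
  "markovian E \<longleftrightarrow>
     (\<forall>\<epsilon>>0. \<exists>\<phi> :: real \<Rightarrow> real.
        (\<forall>t\<in>{0..1}. \<phi> t = t) \<and>
        (\<forall>t. - \<epsilon> \<le> \<phi> t \<and> \<phi> t \<le> 1 + \<epsilon>) \<and>
        (\<forall>t t'. t < t' \<longrightarrow> 0 \<le> \<phi> t' - \<phi> t \<and> \<phi> t' - \<phi> t \<le> t' - t) \<and>
        (\<forall>u\<in>FC. \<phi> \<circ> u \<in> FC \<and> E (\<phi> \<circ> u) (\<phi> \<circ> u) \<le> E u u))"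

text \<open>For \<open>form\<close> and \<open>u\<close>, \<open>v\<close> in \<open>FC\<close> with finite energies the value at the difference
  \<open>u - v\<close>, which need not lie in \<open>FC\<close>, is again given by convergent integrals, because
  $(a - b)^2 \le 2 a^2 + 2 b^2$.\<close>

definition closable_L2 :: "seq measure \<Rightarrow> ((seq \<Rightarrow> real) \<Rightarrow> (seq \<Rightarrow> real) \<Rightarrow> real) \<Rightarrow> bool" where
  "closable_L2 \<mu> E \<longleftrightarrow>
     (\<forall>u :: nat \<Rightarrow> seq \<Rightarrow> real.
        (\<forall>n. u n \<in> FC) \<longrightarrow>
        (\<lambda>n. sqrt (\<integral>x. (u n x)\<^sup>2 \<partial>\<mu>)) \<longlonglongrightarrow> 0 \<longrightarrow>
        ((\<lambda>(n, m). E (\<lambda>x. u n x - u m x) (\<lambda>x. u n x - u m x)) \<longlongrightarrow> 0)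
          (sequentially \<times>\<^sub>F sequentially) \<longrightarrow>
        (\<lambda>n. E (u n) (u n)) \<longlonglongrightarrow> 0)"

end

theory Submission
  imports Defs
begin

text \<open>The bound \<open>(u(y) - u(y'))\<^sup>2 \<le> M\<^sup>2 (y - y')\<^sup>2\<close> reduces the singularity of the kernel to
  \<open>\<bar>y - y'\<bar> powr (1 - \<alpha>)\<close>, which is bounded near the diagonal for \<open>\<alpha> \<le> 1\<close> and integrable against
  a locally bounded density for \<open>\<alpha> < 2\<close>; only finitely many coordinates contribute. Resampling
  the \<open>i\<close>-th coordinate from its conditional distribution leaves \<open>\<mu>\<close> invariant, so a property that
  holds almost everywhere survives the resampling. This gives the independence of representatives,
  and it turns almost everywhere convergence of a subsequence of \<open>u\<^sub>n\<close> into convergence of the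
  integrands of the form, so that closability follows from Fatou's lemma applied to
  \<open>u\<^sub>n - u\<^sub>m\<close> as \<open>m\<close> tends to infinity.\<close>

section \<open>Coordinates on the state spaces\<close>

text \<open>Three obstacles shape the development. The state spaces carry different metrics, and on
  weighted l^infinity the Borel field may exceed the coordinate field; cylinder functions are
  therefore treated as Borel functions on all real sequences with the product topology, and the
  measure enters only through measurable coordinates and the kernels. The integrals in
  \<open>form\<close> have default values when they diverge; inequalities and limits are therefore
  handled with \<open>ennreal\<close> energies, and \<open>form_eq_energy\<close> translates back
  once finiteness is known. \<open>FC\<close> is not closed under differences, since a nonzero
  compactly supported function of n variables loses compact support when read in more variables; the
  class \<open>finite_energy\<close> contains \<open>FC\<close>, is closed under differences, and is
  where the translation is proved. A merely local bound on the density suffices because near the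
  diagonal compact support confines the integrand to a fixed compact set of values \<open>y\<close>,
  while away from the diagonal the boundedness of \<open>u\<close> and the total mass 1 of the
  conditional distribution take over.\<close>

lemma openin_mtopology_coordinate:
  assumes M: "Metric_space S d" and "0 \<le> C"
    and le: "\<And>x y. x \<in> S \<Longrightarrow> y \<in> S \<Longrightarrow> \<bar>x i - y i\<bar> \<le> C * d x y"
    and U: "open (U :: real set)"
  shows "openin (Metric_space.mtopology S d) {x \<in> S. x i \<in> U}"
proof -
  interpret Metric_space S d by fact
  have "\<exists>r>0. mball x r \<subseteq> {x \<in> S. x i \<in> U}" if x: "x \<in> S" "x i \<in> U" for x
  proof -
    obtain e where e: "e > 0" "\<And>t. \<bar>x i - t\<bar> < e \<Longrightarrow> t \<in> U"
      using U x(2) by (metis open_dist dist_real_def abs_minus_commute)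
    \<comment> \<open>Dividing by \<open>C + 1\<close> instead of \<open>C\<close> covers
      \<open>C = 0\<close>.\<close>
    have "mball x (e / (C + 1)) \<subseteq> {x \<in> S. x i \<in> U}"
    proof
      fix y assume y: "y \<in> mball x (e / (C + 1))"
      have "\<bar>x i - y i\<bar> \<le> C * d x y" using y le by auto
      also have "\<dots> \<le> (C + 1) * d x y" using nonneg[of x y] by (simp add: algebra_simps)
      also have "\<dots> < e" using y \<open>0 \<le> C\<close> by (simp add: field_simps)
      finally show "y \<in> {x \<in> S. x i \<in> U}" using e y by auto
    qed
    then show ?thesis using e \<open>0 \<le> C\<close> by (intro exI[of _ "e / (C + 1)"]) auto
  qed
  then show ?thesis by (auto simp: openin_mtopology)
qed

section \<open>The weighted l^p spaces: Minkowski's inequality and the metric\<close>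

lemma powr_convex_nonneg:
  fixes p s a b :: real
  assumes "1 \<le> p" "0 \<le> s" "s \<le> 1" "0 \<le> a" "0 \<le> b"
  shows "(s * a + (1 - s) * b) powr p \<le> s * a powr p + (1 - s) * b powr p"
proof -
  \<comment> \<open>If \<open>a\<close> or \<open>b\<close> vanishes, convexity reduces to
    \<open>r powr p \<le> r\<close> on the unit interval; on the open half line it is
    \<open>powr_convex\<close>.\<close>
  have scale: "(r * v) powr p \<le> r * v powr p" if "0 \<le> r" "r \<le> 1" "0 \<le> v" for r v :: real
  proof -
    have "r powr p \<le> r"
    proof (cases "r = 0")
      case False
      then have "r powr p \<le> r powr 1" using that assms(1) by (intro powr_mono') auto
      then show ?thesis using that by simp
    qed auto
    then show ?thesis using that by (simp add: powr_mult mult_right_mono)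
  qed
  consider "a = 0" | "b = 0" | "a > 0" "b > 0" using assms by linarith
  then show ?thesis
  proof cases
    case 1 then show ?thesis using scale[of "1 - s" b] assms by simp
  next
    case 2 then show ?thesis using scale[of s a] assms by simp
  next
    case 3
    have "convex_on {0<..} (\<lambda>x. x powr p)" using assms by (intro powr_convex)
    from convex_onD[OF this, of "1 - s" a b] show ?thesis using 3 assms by (simp add: algebra_simps)
  qed
qed

text \<open>Serves twice: for the definiteness of the norm, and for the Lipschitz bound on
  coordinate \<open>i\<close>, with constant \<open>1 / \<beta> i powr (1/p)\<close>.\<close>

lemma lp_term_le:
  assumes "1 \<le> p" "\<forall>i. 0 < \<beta> i" "x \<in> lp_space p \<beta>"
  shows "\<beta> i powr (1/p) * \<bar>x i\<bar> \<le> lp_norm p \<beta> x"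
proof -
  have sm: "summable (\<lambda>i. \<beta> i * \<bar>x i\<bar> powr p)" using assms by (simp add: lp_space_def)
  have nn: "0 \<le> \<beta> j * \<bar>x j\<bar> powr p" for j using assms(2) by (simp add: less_imp_le)
  have "\<beta> i * \<bar>x i\<bar> powr p \<le> (\<Sum>i. \<beta> i * \<bar>x i\<bar> powr p)"
    using sum_le_suminf[OF sm, of "{i}"] nn by simp
  then have "(\<beta> i * \<bar>x i\<bar> powr p) powr (1/p) \<le> lp_norm p \<beta> x"
    unfolding lp_norm_def using nn assms(1) by (intro powr_mono2) auto
  moreover have "(\<beta> i * \<bar>x i\<bar> powr p) powr (1/p) = \<beta> i powr (1/p) * \<bar>x i\<bar>"
    using assms by (simp add: powr_mult powr_powr less_imp_le)
  ultimately show ?thesis by simp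
qed

lemma lp_norm_pos:
  assumes "1 \<le> p" "\<forall>i. 0 < \<beta> i" "x \<in> lp_space p \<beta>" "x \<noteq> (\<lambda>_. 0)"
  shows "0 < lp_norm p \<beta> x"
proof -
  obtain i where "x i \<noteq> 0" using assms(4) by auto
  then have "0 < \<beta> i powr (1/p) * \<bar>x i\<bar>" using assms(2)[rule_format, of i] by simp
  with lp_term_le[OF assms(1-3), of i] show ?thesis by linarith
qed

lemma lp_norm_powr:
  assumes "1 \<le> p" "\<forall>i. 0 < \<beta> i" "x \<in> lp_space p \<beta>"
  shows "(\<Sum>i. \<beta> i * \<bar>x i\<bar> powr p) = lp_norm p \<beta> x powr p"
proof -
  have "0 \<le> (\<Sum>i. \<beta> i * \<bar>x i\<bar> powr p)"
    using assms by (intro suminf_nonneg) (auto simp: lp_space_def less_imp_le)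
  then show ?thesis using assms(1) by (simp add: lp_norm_def powr_powr)
qed

text \<open>With both norms \<open>a\<close> and \<open>b\<close> positive,
  \<open>(x + y) / (a + b)\<close> is the convex combination of the unit vectors
  \<open>x / a\<close> and \<open>y / b\<close> with weights \<open>s = a / (a + b)\<close> and
  \<open>1 - s\<close>. Convexity of the power, applied termwise and summed, gives membership and
  the triangle inequality together, without Hoelder. The zero sequence is split off because
  \<open>a\<close> and \<open>b\<close> are divisors.\<close>

lemma lp_minkowski:
  assumes p: "1 \<le> p" and \<beta>: "\<forall>i. 0 < \<beta> i" and x: "x \<in> lp_space p \<beta>" and y: "y \<in> lp_space p \<beta>"
  shows "(\<lambda>i. x i + y i) \<in> lp_space p \<beta> \<and>
    lp_norm p \<beta> (\<lambda>i. x i + y i) \<le> lp_norm p \<beta> x + lp_norm p \<beta> y"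
proof (cases "x = (\<lambda>_. 0) \<or> y = (\<lambda>_. 0)")
  case True
  then show ?thesis
  proof
    assume "x = (\<lambda>_. 0)" then show ?thesis using y by (simp add: lp_norm_def)
  next
    assume "y = (\<lambda>_. 0)" then show ?thesis using x by (simp add: lp_norm_def)
  qed
next
  case False
  define a where "a = lp_norm p \<beta> x"
  define b where "b = lp_norm p \<beta> y"
  have pos: "0 < a" "0 < b" using False lp_norm_pos[OF p \<beta>] x y by (auto simp: a_def b_def)
  define s where "s = a / (a + b)"
  have s: "0 \<le> s" "s \<le> 1" using pos by (auto simp: s_def)
  have s': "1 - s = b / (a + b)" using pos by (simp add: s_def field_simps)
  have bound: "\<bar>x i + y i\<bar> powr p \<le>
      (a + b) powr p * (s * (\<bar>x i\<bar> powr p / a powr p) + (1 - s) * (\<bar>y i\<bar> powr p / b powr p))" for i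
  proof -
    have "\<bar>x i + y i\<bar> \<le> \<bar>x i\<bar> + \<bar>y i\<bar>" by (rule abs_triangle_ineq)
    also have "\<dots> = (a + b) * (s * (\<bar>x i\<bar> / a) + (1 - s) * (\<bar>y i\<bar> / b))"
    proof -
      have "(a + b) * s = a" using pos by (simp add: s_def)
      moreover have "(a + b) * (1 - s) = b" using pos unfolding s' by simp
      ultimately
      have "(a + b) * (s * (\<bar>x i\<bar> / a) + (1 - s) * (\<bar>y i\<bar> / b)) = a * (\<bar>x i\<bar> / a) + b * (\<bar>y i\<bar> / b)"
        by (simp only: distrib_left mult.assoc[symmetric])
      then show ?thesis using pos by simp
    qed
    finally have "\<bar>x i + y i\<bar> powr p \<le> ((a + b) * (s * (\<bar>x i\<bar> / a) + (1 - s) * (\<bar>y i\<bar> / b))) powr p"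
      using p by (intro powr_mono2) auto
    also have "\<dots> = (a + b) powr p * (s * (\<bar>x i\<bar> / a) + (1 - s) * (\<bar>y i\<bar> / b)) powr p"
      by (rule powr_mult)
    also have "\<dots> \<le> (a + b) powr p * (s * (\<bar>x i\<bar> / a) powr p + (1 - s) * (\<bar>y i\<bar> / b) powr p)"
      using pos s p by (intro mult_left_mono powr_convex_nonneg) auto
    also have "\<dots> = (a + b) powr p * (s * (\<bar>x i\<bar> powr p / a powr p) + (1 - s) * (\<bar>y i\<bar> powr p / b powr p))"
      using pos by (simp add: powr_divide)
    finally show ?thesis .
  qed
  have sx: "(\<lambda>i. \<beta> i * \<bar>x i\<bar> powr p) sums (a powr p)"
    using x summable_sums[of "\<lambda>i. \<beta> i * \<bar>x i\<bar> powr p"]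
    by (simp add: a_def lp_space_def lp_norm_powr[OF p \<beta> x])
  have sy: "(\<lambda>i. \<beta> i * \<bar>y i\<bar> powr p) sums (b powr p)"
    using y summable_sums[of "\<lambda>i. \<beta> i * \<bar>y i\<bar> powr p"]
    by (simp add: b_def lp_space_def lp_norm_powr[OF p \<beta> y])
  \<comment> \<open>Both normalized series sum to 1 and the weights add up to 1, so the majorant
    sums to \<open>(a + b) powr p\<close>.\<close>
  have "(\<lambda>i. (a + b) powr p * (s * ((\<beta> i * \<bar>x i\<bar> powr p) / a powr p) + (1 - s) * ((\<beta> i * \<bar>y i\<bar> powr p) / b powr p)))
     sums ((a + b) powr p * (s * (a powr p / a powr p) + (1 - s) * (b powr p / b powr p)))"
    by (intro sums_mult sums_add sums_divide sx sy)
  also have "(a + b) powr p * (s * (a powr p / a powr p) + (1 - s) * (b powr p / b powr p)) = (a + b) powr p"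
    using pos by simp
  finally have sb: "(\<lambda>i. (a + b) powr p * (s * ((\<beta> i * \<bar>x i\<bar> powr p) / a powr p) + (1 - s) * ((\<beta> i * \<bar>y i\<bar> powr p) / b powr p)))
     sums ((a + b) powr p)" .
  have le: "\<beta> i * \<bar>x i + y i\<bar> powr p \<le> (a + b) powr p * (s * ((\<beta> i * \<bar>x i\<bar> powr p) / a powr p) + (1 - s) * ((\<beta> i * \<bar>y i\<bar> powr p) / b powr p))" for i
    using mult_left_mono[OF bound[of i], of "\<beta> i"] \<beta>[rule_format, of i] by (simp add: algebra_simps)
  have nn: "0 \<le> \<beta> i * \<bar>x i + y i\<bar> powr p" for i using \<beta> by (simp add: less_imp_le)
  have sm: "summable (\<lambda>i. \<beta> i * \<bar>x i + y i\<bar> powr p)"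
    by (rule summable_comparison_test'[OF sums_summable[OF sb], of 0]) (use nn le in auto)
  have "(\<Sum>i. \<beta> i * \<bar>x i + y i\<bar> powr p) \<le> (a + b) powr p"
    using suminf_le[OF le sm sums_summable[OF sb]] sums_unique[OF sb] by simp
  then have "lp_norm p \<beta> (\<lambda>i. x i + y i) \<le> ((a + b) powr p) powr (1/p)"
    unfolding lp_norm_def using p by (intro powr_mono2 suminf_nonneg sm nn) auto
  also have "\<dots> = a + b" using pos p by (simp add: powr_powr)
  finally show ?thesis using sm by (simp add: lp_space_def a_def b_def)
qed

lemma lp_diff:
  assumes "1 \<le> p" "\<forall>i. 0 < \<beta> i" "x \<in> lp_space p \<beta>" "y \<in> lp_space p \<beta>"
  shows "(\<lambda>i. x i - y i) \<in> lp_space p \<beta>"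
proof -
  have "(\<lambda>i. - y i) \<in> lp_space p \<beta>" using assms(4) by (simp add: lp_space_def)
  from conjunct1[OF lp_minkowski[OF assms(1-3) this]] show ?thesis by simp
qed

lemma Metric_space_lp:
  assumes p: "1 \<le> p" and \<beta>: "\<forall>i. 0 < \<beta> i"
  shows "Metric_space (lp_space p \<beta>) (\<lambda>x y. lp_norm p \<beta> (\<lambda>i. x i - y i))"
proof
  show "0 \<le> lp_norm p \<beta> (\<lambda>i. x i - y i)" for x y by (simp add: lp_norm_def)
  show "lp_norm p \<beta> (\<lambda>i. x i - y i) = lp_norm p \<beta> (\<lambda>i. y i - x i)" for x y
    by (simp add: lp_norm_def abs_minus_commute)
  show "lp_norm p \<beta> (\<lambda>i. x i - y i) = 0 \<longleftrightarrow> x = y"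
    if "x \<in> lp_space p \<beta>" "y \<in> lp_space p \<beta>" for x y
  proof
    assume "lp_norm p \<beta> (\<lambda>i. x i - y i) = 0"
    then have "(\<lambda>i. x i - y i) = (\<lambda>_. 0)" using lp_norm_pos[OF p \<beta> lp_diff[OF p \<beta> that]] by fastforce
    then have "x i - y i = 0" for i by (rule fun_cong)
    then show "x = y" by auto
  qed (simp add: lp_norm_def)
  show "lp_norm p \<beta> (\<lambda>i. x i - z i) \<le> lp_norm p \<beta> (\<lambda>i. x i - y i) + lp_norm p \<beta> (\<lambda>i. y i - z i)"
    if "x \<in> lp_space p \<beta>" "y \<in> lp_space p \<beta>" "z \<in> lp_space p \<beta>" for x y z
    using lp_minkowski[OF p \<beta> lp_diff[OF p \<beta> that(1,2)] lp_diff[OF p \<beta> that(2,3)]] by simp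
qed

section \<open>The weighted l^infinity spaces\<close>

lemma linf_diff:
  assumes "\<forall>i. 0 < \<beta> i" "x \<in> linf_space \<beta>" "y \<in> linf_space \<beta>"
  shows "(\<lambda>i. x i - y i) \<in> linf_space \<beta>"
proof -
  obtain A B where A: "\<And>i. \<beta> i * \<bar>x i\<bar> \<le> A" and B: "\<And>i. \<beta> i * \<bar>y i\<bar> \<le> B"
    using assms(2,3) by (auto simp: linf_space_def bdd_above_def)
  have "\<beta> i * \<bar>x i - y i\<bar> \<le> A + B" for i
  proof -
    have "\<beta> i * \<bar>x i - y i\<bar> \<le> \<beta> i * (\<bar>x i\<bar> + \<bar>y i\<bar>)"
      using assms(1) by (intro mult_left_mono abs_triangle_ineq4) (simp add: less_imp_le)
    then show ?thesis using A[of i] B[of i] by (simp add: algebra_simps)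
  qed
  then show ?thesis by (auto simp: linf_space_def bdd_above_def)
qed

lemma linf_term_le:
  assumes "x \<in> linf_space \<beta>"
  shows "\<beta> i * \<bar>x i\<bar> \<le> linf_norm \<beta> x"
  using assms unfolding linf_norm_def linf_space_def by (auto intro: cSUP_upper)

lemma linf_norm_nonneg:
  assumes "\<forall>i. 0 < \<beta> i" shows "0 \<le> linf_norm \<beta> x"
proof (cases "x \<in> linf_space \<beta>")
  case True
  have "0 \<le> \<beta> 0 * \<bar>x 0\<bar>" using assms by (simp add: less_imp_le)
  also have "\<dots> \<le> linf_norm \<beta> x" by (rule linf_term_le[OF True])
  finally show ?thesis .
qed (simp add: linf_norm_def)

lemma Metric_space_linf:
  assumes \<beta>: "\<forall>i. 0 < \<beta> i"
  shows "Metric_space (linf_space \<beta>) (\<lambda>x y. linf_norm \<beta> (\<lambda>i. x i - y i))"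
proof
  show "0 \<le> linf_norm \<beta> (\<lambda>i. x i - y i)" for x y by (rule linf_norm_nonneg[OF \<beta>])
  show "linf_norm \<beta> (\<lambda>i. x i - y i) = linf_norm \<beta> (\<lambda>i. y i - x i)" for x y
    by (simp add: linf_norm_def linf_space_def abs_minus_commute)
  show "linf_norm \<beta> (\<lambda>i. x i - y i) = 0 \<longleftrightarrow> x = y"
    if xy: "x \<in> linf_space \<beta>" "y \<in> linf_space \<beta>" for x y
  proof
    assume 0: "linf_norm \<beta> (\<lambda>i. x i - y i) = 0"
    have "x i = y i" for i
    proof -
      have "\<beta> i * \<bar>x i - y i\<bar> \<le> 0" using linf_term_le[OF linf_diff[OF \<beta> xy], of i] 0 by simp
      then show ?thesis using \<beta>[rule_format, of i] by (simp add: mult_le_0_iff)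
    qed
    then show "x = y" by auto
  qed (simp add: linf_norm_def)
  show "linf_norm \<beta> (\<lambda>i. x i - z i) \<le> linf_norm \<beta> (\<lambda>i. x i - y i) + linf_norm \<beta> (\<lambda>i. y i - z i)"
    if xyz: "x \<in> linf_space \<beta>" "y \<in> linf_space \<beta>" "z \<in> linf_space \<beta>" for x y z
  proof -
    have "\<beta> i * \<bar>x i - z i\<bar> \<le> linf_norm \<beta> (\<lambda>i. x i - y i) + linf_norm \<beta> (\<lambda>i. y i - z i)" for i
    proof -
      have "\<beta> i * \<bar>x i - z i\<bar> \<le> \<beta> i * (\<bar>x i - y i\<bar> + \<bar>y i - z i\<bar>)"
        using \<beta> by (intro mult_left_mono) (auto simp: less_imp_le)
      then show ?thesis
        using linf_term_le[OF linf_diff[OF \<beta> xyz(1,2)], of i] linf_term_le[OF linf_diff[OF \<beta> xyz(2,3)], of i]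
        by (simp add: algebra_simps)
    qed
    then show ?thesis
      using linf_diff[OF \<beta> xyz(1,3)] by (subst linf_norm_def) (auto intro!: cSUP_least)
  qed
qed

section \<open>The product metric on all real sequences\<close>

lemma product_dist_summable:
  "summable (\<lambda>k. (1/2) ^ Suc k * (L2_set (\<lambda>i. x i - y i) {..k} / (L2_set (\<lambda>i. x i - y i) {..k} + 1)))"
proof (rule summable_comparison_test')
  show "summable (\<lambda>k. (1/2::real) ^ Suc k)" by (simp add: summable_geometric)
  show "norm ((1/2) ^ Suc k * (L2_set (\<lambda>i. x i - y i) {..k} / (L2_set (\<lambda>i. x i - y i) {..k} + 1)))
     \<le> (1/2) ^ Suc k" if "k \<ge> 0" for k
  proof -
    have "L2_set (\<lambda>i. x i - y i) {..k} / (L2_set (\<lambda>i. x i - y i) {..k} + 1) \<le> 1"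
      using L2_set_nonneg[of "\<lambda>i. x i - y i" "{..k}"] by (smt (verit) divide_le_eq_1)
    moreover have "0 \<le> L2_set (\<lambda>i. x i - y i) {..k} / (L2_set (\<lambda>i. x i - y i) {..k} + 1)"
      by (intro divide_nonneg_nonneg L2_set_nonneg add_nonneg_nonneg) auto
    ultimately show ?thesis
      by (simp only: real_norm_def abs_mult abs_of_nonneg zero_le_power zero_le_divide_1_iff zero_le_numeral
          mult_left_le)
  qed
qed

lemma product_dist_term_nonneg:
  "0 \<le> (1/2::real) ^ Suc k * (L2_set (\<lambda>i. x i - y i) {..k} / (L2_set (\<lambda>i. x i - y i) {..k} + 1))"
  by (intro mult_nonneg_nonneg divide_nonneg_nonneg L2_set_nonneg add_nonneg_nonneg) auto

lemma product_dist_term_le: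
  "(1/2) ^ Suc k * (L2_set (\<lambda>i. x i - y i) {..k} / (L2_set (\<lambda>i. x i - y i) {..k} + 1)) \<le> product_dist x y"
  unfolding product_dist_def
  using sum_le_suminf[OF product_dist_summable[of x y], of "{k}"] product_dist_term_nonneg by simp

text \<open>Monotonicity of \<open>t / (t + 1)\<close> replaces \<open>c\<close> by
  \<open>a + b\<close>; then the common denominator is shrunk in each part. Applied to the
  seminorms, this gives the triangle inequality for \<open>product_dist\<close> term by
  term.\<close>

lemma fraction_subadditive:
  fixes a b c :: real
  assumes "0 \<le> a" "0 \<le> b" "0 \<le> c" "c \<le> a + b"
  shows "c / (c + 1) \<le> a / (a + 1) + b / (b + 1)"
proof -
  have "c / (c + 1) \<le> (a + b) / (a + b + 1)" using assms by (simp add: field_simps)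
  also have "\<dots> = a / (a + b + 1) + b / (a + b + 1)" by (simp add: add_divide_distrib)
  also have "\<dots> \<le> a / (a + 1) + b / (b + 1)"
    using assms by (intro add_mono divide_left_mono) auto
  finally show ?thesis .
qed

lemma Metric_space_product: "Metric_space UNIV product_dist"
proof
  show "0 \<le> product_dist x y" for x y
    unfolding product_dist_def by (intro suminf_nonneg product_dist_summable product_dist_term_nonneg)
  show "product_dist x y = product_dist y x" for x y
    by (simp add: product_dist_def L2_set_def power2_commute)
  show "product_dist x y = 0 \<longleftrightarrow> x = y" for x y
  proof
    assume 0: "product_dist x y = 0"
    have "x k = y k" for k
    proof -
      have "L2_set (\<lambda>i. x i - y i) {..k} / (L2_set (\<lambda>i. x i - y i) {..k} + 1) \<le> 0"
        using product_dist_term_le[of k x y] 0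
        by (metis mult_le_cancel_left_pos mult_zero_right zero_less_power half_gt_zero_iff zero_less_one)
      then have "L2_set (\<lambda>i. x i - y i) {..k} = 0"
        using L2_set_nonneg[of "\<lambda>i. x i - y i" "{..k}"] by (simp add: divide_le_0_iff)
      then show ?thesis by (simp add: L2_set_eq_0_iff)
    qed
    then show "x = y" by auto
  qed (simp add: product_dist_def L2_set_def)
  show "product_dist x z \<le> product_dist x y + product_dist y z" for x y z
  proof -
    have "L2_set (\<lambda>i. x i - z i) {..k} \<le> L2_set (\<lambda>i. x i - y i) {..k} + L2_set (\<lambda>i. y i - z i) {..k}" for k
      using L2_set_triangle_ineq[of "\<lambda>i. x i - y i" "\<lambda>i. y i - z i" "{..k}"] by simp
    then have "(1/2) ^ Suc k * (L2_set (\<lambda>i. x i - z i) {..k} / (L2_set (\<lambda>i. x i - z i) {..k} + 1)) \<le>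
       (1/2) ^ Suc k * (L2_set (\<lambda>i. x i - y i) {..k} / (L2_set (\<lambda>i. x i - y i) {..k} + 1)) +
       (1/2) ^ Suc k * (L2_set (\<lambda>i. y i - z i) {..k} / (L2_set (\<lambda>i. y i - z i) {..k} + 1))" for k
      unfolding distrib_left[symmetric]
      by (intro mult_left_mono fraction_subadditive L2_set_nonneg) auto
    then show ?thesis
      unfolding product_dist_def suminf_add[OF product_dist_summable product_dist_summable]
      by (intro suminf_le product_dist_summable summable_add)
  qed
qed

text \<open>\<open>product_dist\<close> is bounded while the coordinates are not, so there is no
  global Lipschitz bound and \<open>openin_mtopology_coordinate\<close> cannot be applied.\<close>

lemma openin_product_dist_coordinate:
  assumes U: "open (U :: real set)"
  shows "openin (Metric_space.mtopology UNIV product_dist) {x. x i \<in> U}"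
proof -
  interpret Metric_space UNIV product_dist by (rule Metric_space_product)
  have "\<exists>r>0. mball x r \<subseteq> {x. x i \<in> U}" if x: "x i \<in> U" for x
  proof -
    obtain e where e: "e > 0" "\<And>t. \<bar>x i - t\<bar> < e \<Longrightarrow> t \<in> U"
      using U x by (metis open_dist dist_real_def abs_minus_commute)
    \<comment> \<open>The value of the term with index \<open>i\<close> when its seminorm equals
      \<open>e\<close>. A distance below it forces the seminorm below \<open>e\<close>, as
      \<open>t / (t + 1)\<close> is increasing.\<close>
    define r where "r = (1/2) ^ Suc i * (e / (e + 1))"
    have "\<bar>x i - y i\<bar> < e" if "product_dist x y < r" for y
    proof -
      define l where "l = L2_set (\<lambda>i. x i - y i) {..i}"
      have l0: "0 \<le> l" by (simp add: l_def L2_set_nonneg)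
      have "(1/2) ^ Suc i * (l / (l + 1)) < (1/2) ^ Suc i * (e / (e + 1))"
        using product_dist_term_le[of i x y] that by (simp add: l_def r_def)
      then have "l / (l + 1) < e / (e + 1)" by (rule mult_left_less_imp_less) simp
      then have "l < e" using l0 e(1) by (simp add: field_simps)
      moreover have "\<bar>x i - y i\<bar> \<le> l"
        using member_le_L2_set[of "{..i}" i "\<lambda>i. \<bar>x i - y i\<bar>"] by (simp add: l_def L2_set_def)
      ultimately show ?thesis by simp
    qed
    then have "mball x r \<subseteq> {x. x i \<in> U}" using e by auto
    then show ?thesis using e by (intro exI[of _ r]) (auto simp: r_def)
  qed
  then show ?thesis by (auto simp: openin_mtopology)
qed

text \<open>The interface to the rest of the proof, where the particular metric no longer
  appears.\<close>

lemma state_space_measurable: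
  assumes S: "state_space S d"
  shows "space (metric_borel S d) = S" "(\<lambda>x. x i) \<in> borel_measurable (metric_borel S d)"
proof -
  \<comment> \<open>The metric axioms are carried along because they place the open sets inside
    \<open>S\<close>, as \<open>sigma\<close> requires of its generators.\<close>
  have main: "Metric_space S d \<and> (\<forall>i. \<forall>U::real set. open U \<longrightarrow> openin (Metric_space.mtopology S d) {x \<in> S. x i \<in> U})"
    using S unfolding state_space_def
  proof (elim disjE exE conjE)
    fix p \<beta> assume p: "1 \<le> p" and \<beta>: "\<forall>i. 0 < \<beta> i" and S: "S = lp_space p \<beta>"
      and d: "d = (\<lambda>x y. lp_norm p \<beta> (\<lambda>i. x i - y i))"
    have M: "Metric_space S d" unfolding S d by (rule Metric_space_lp[OF p \<beta>])
    have "\<bar>x i - y i\<bar> \<le> 1 / \<beta> i powr (1/p) * d x y" if "x \<in> S" "y \<in> S" for x y i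
      using lp_term_le[OF p \<beta> lp_diff[OF p \<beta>], of x y i] that \<beta>[rule_format, of i]
      by (simp add: S d field_simps)
    moreover have "0 \<le> 1 / \<beta> i powr (1/p)" for i by simp
    ultimately show ?thesis using M openin_mtopology_coordinate[OF M] by blast
  next
    fix \<beta> assume \<beta>: "\<forall>i. 0 < \<beta> i" and S: "S = linf_space \<beta>"
      and d: "d = (\<lambda>x y. linf_norm \<beta> (\<lambda>i. x i - y i))"
    have M: "Metric_space S d" unfolding S d by (rule Metric_space_linf[OF \<beta>])
    have "\<bar>x i - y i\<bar> \<le> 1 / \<beta> i * d x y" if "x \<in> S" "y \<in> S" for x y i
      using linf_term_le[OF linf_diff[OF \<beta>], of x y i] that \<beta>[rule_format, of i]
      by (simp add: S d field_simps)
    moreover have "0 \<le> 1 / \<beta> i" for i using \<beta>[rule_format, of i] by simp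
    ultimately show ?thesis using M openin_mtopology_coordinate[OF M] by blast
  next
    assume "S = UNIV" "d = product_dist"
    then show ?thesis using Metric_space_product openin_product_dist_coordinate by auto
  qed
  interpret Metric_space S d using main by blast
  have "U \<subseteq> S" if "openin mtopology U" for U using openin_subset[OF that] by simp
  then have sub: "{U. openin mtopology U} \<subseteq> Pow S" by blast
  show sp: "space (metric_borel S d) = S" unfolding metric_borel_def using sub by simp
  show "(\<lambda>x. x i) \<in> borel_measurable (metric_borel S d)"
  proof (rule borel_measurableI)
    fix U :: "real set" assume U: "open U"
    have "{x \<in> S. x i \<in> U} \<in> sets (metric_borel S d)"
      unfolding metric_borel_def using sub main U by auto
    moreover have "{x \<in> S. x i \<in> U} = (\<lambda>x. x i) -` U \<inter> space (metric_borel S d)"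
      by (auto simp: sp)
    ultimately show "(\<lambda>x. x i) -` U \<inter> space (metric_borel S d) \<in> sets (metric_borel S d)"
      by simp
  qed
qed

section \<open>Resampling one coordinate\<close>

lemma space_sigma_off [simp]: "space (sigma_off S i) = S"
  unfolding sigma_off_def by (subst space_measure_of) auto

lemma coordinate_measurable_sigma_off:
  assumes "j \<noteq> i"
  shows "(\<lambda>x. x j) \<in> borel_measurable (sigma_off S i)"
proof (rule measurableI)
  fix A :: "real set" assume A: "A \<in> sets borel"
  have "{x \<in> S. \<forall>k\<in>{j}. x k \<in> A} \<in> sets (sigma_off S i)"
    unfolding sigma_off_def
    by (rule in_measure_of) (use A assms in \<open>auto intro!: exI[of _ "{j}"] exI[of _ "\<lambda>_. A"]\<close>)
  moreover have "{x \<in> S. \<forall>k\<in>{j}. x k \<in> A} = (\<lambda>x. x j) -` A \<inter> space (sigma_off S i)" by auto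
  ultimately show "(\<lambda>x. x j) -` A \<inter> space (sigma_off S i) \<in> sets (sigma_off S i)" by simp
qed simp

text \<open>Overwriting coordinate \<open>i\<close> discards the one coordinate that does not enter
  \<open>sigma_off S i\<close>; the new value comes from the second factor. This makes
  \<open>disintegration\<close> applicable to functions of the resampled sequence.\<close>

lemma update_measurable_sigma_off:
  "(\<lambda>(x, y). x(i := y)) \<in> borel_measurable (sigma_off S i \<Otimes>\<^sub>M borel)"
proof (rule measurable_coordinatewise_then_product)
  fix j
  show "(\<lambda>p. (case p of (x, y) \<Rightarrow> x(i := y)) j) \<in> borel_measurable (sigma_off S i \<Otimes>\<^sub>M borel)"
  proof (cases "j = i")
    case True
    then have "(\<lambda>p. (case p of (x, y) \<Rightarrow> x(i := y)) j) = (snd :: seq \<times> real \<Rightarrow> real)" by (auto simp: fun_eq_iff)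
    then show ?thesis by simp
  next
    case False
    then have "(\<lambda>p. (case p of (x, y) \<Rightarrow> x(i := y)) j) = (\<lambda>p :: seq \<times> real. fst p j)" by (auto simp: fun_eq_iff)
    then show ?thesis
      using measurable_compose[OF measurable_fst coordinate_measurable_sigma_off[OF False]] by simp
  qed
qed

text \<open>Of \<open>sets \<mu>\<close> only the measurability of the coordinates is recorded, so
  that all state spaces, the nonseparable ones included, are treated at once.\<close>

locale conditional_system = prob_space \<mu> for \<mu> :: "seq measure" +
  fixes S :: "seq set" and \<kappa> :: "nat \<Rightarrow> seq \<Rightarrow> real measure"
  assumes space_mu [simp]: "space \<mu> = S"
    and coordinate_measurable [measurable]: "(\<lambda>x. x i) \<in> borel_measurable \<mu>"
    and cond: "cond_dist S \<mu> i (\<kappa> i)"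
begin

text \<open>The inclusion of a sub-sigma-field in \<open>sets \<mu>\<close>, phrased as
  measurability of the identity so that it composes with other maps.\<close>

lemma id_measurable_sigma_off: "(\<lambda>x. x) \<in> measurable \<mu> (sigma_off S i)"
  unfolding sigma_off_def
proof (rule measurable_measure_of)
  fix A assume "A \<in> {{x \<in> S. \<forall>j\<in>J. x j \<in> B j} | J B. finite J \<and> i \<notin> J \<and> (\<forall>j\<in>J. B j \<in> sets (borel::real measure))}"
  then obtain J B where A: "A = {x \<in> S. \<forall>j\<in>J. x j \<in> B j}" and J: "finite J"
    and B: "\<And>j. j \<in> J \<Longrightarrow> B j \<in> sets (borel :: real measure)" by blast
  have "{x \<in> space \<mu>. \<forall>j\<in>J. x j \<in> B j} \<in> sets \<mu>"
  proof (rule sets.sets_Collect_finite_All[OF _ J])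
    fix j assume "j \<in> J"
    have "(\<lambda>x. x j) -` B j \<inter> space \<mu> \<in> sets \<mu>"
      by (rule measurable_sets[OF coordinate_measurable B]) fact
    moreover have "(\<lambda>x. x j) -` B j \<inter> space \<mu> = {x \<in> space \<mu>. x j \<in> B j}" by auto
    ultimately show "{x \<in> space \<mu>. x j \<in> B j} \<in> sets \<mu>" by simp
  qed
  moreover have "(\<lambda>x. x) -` A \<inter> space \<mu> = {x \<in> space \<mu>. \<forall>j\<in>J. x j \<in> B j}" by (auto simp: A)
  ultimately show "(\<lambda>x. x) -` A \<inter> space \<mu> \<in> sets \<mu>" by simp
qed auto

lemma kernel_measurable [measurable]: "\<kappa> i \<in> measurable \<mu> (prob_algebra borel)"
  by (rule measurable_compose[OF id_measurable_sigma_off conjunct1[OF cond[unfolded cond_dist_def]]])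

lemma kernel_measurable_subprob [measurable]: "\<kappa> i \<in> measurable \<mu> (subprob_algebra borel)"
  by (rule measurable_prob_algebraD[OF kernel_measurable])

lemma kernel_props:
  assumes "x \<in> S"
  shows "prob_space (\<kappa> i x)" "sets (\<kappa> i x) = sets borel" "space (\<kappa> i x) = UNIV"
proof -
  have "\<kappa> i x \<in> space (prob_algebra borel)"
    using measurable_space[OF kernel_measurable, of x i] assms by simp
  then show "prob_space (\<kappa> i x)" "sets (\<kappa> i x) = sets borel" by (auto simp: space_prob_algebra)
  then show "space (\<kappa> i x) = UNIV" using sets_eq_imp_space_eq[of "\<kappa> i x" borel] by simp
qed

lemma pair_id_measurable: "(\<lambda>p. p) \<in> measurable (\<mu> \<Otimes>\<^sub>M borel) (sigma_off S i \<Otimes>\<^sub>M borel)"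
proof -
  have "(\<lambda>p. (fst p, snd p)) \<in> measurable (\<mu> \<Otimes>\<^sub>M borel) (sigma_off S i \<Otimes>\<^sub>M borel)"
    by (intro measurable_Pair measurable_compose[OF measurable_fst id_measurable_sigma_off] measurable_snd)
  then show ?thesis by simp
qed

lemma update_measurable [measurable]: "(\<lambda>(x, y). x(i := y)) \<in> borel_measurable (\<mu> \<Otimes>\<^sub>M borel)"
  using measurable_compose[OF pair_id_measurable update_measurable_sigma_off] .

text \<open>The defining identity of \<open>cond_dist\<close> is this equality on rectangles, which
  form an intersection-stable generator. The first factor carries \<open>sigma_off S i\<close> on
  purpose: under the field of \<open>\<mu>\<close> the first component would reveal
  \<open>x i\<close>, and the two laws would differ in general.\<close>

lemma disintegration_measure:
  "distr \<mu> (sigma_off S i \<Otimes>\<^sub>M borel) (\<lambda>x. (x, x i)) =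
   \<mu> \<bind> (\<lambda>x. distr (\<kappa> i x) (sigma_off S i \<Otimes>\<^sub>M borel) (\<lambda>y. (x, y)))"
  (is "?D = \<mu> \<bind> ?k")
proof -
  let ?N = "sigma_off S i \<Otimes>\<^sub>M (borel :: real measure)"
  let ?E = "{a \<times> b | a b. a \<in> sets (sigma_off S i) \<and> b \<in> sets (borel :: real measure)}"
  have pm [measurable]: "(\<lambda>x. (x, x i)) \<in> measurable \<mu> ?N"
    by (intro measurable_Pair id_measurable_sigma_off coordinate_measurable)
  have k: "?k \<in> measurable \<mu> (subprob_algebra ?N)"
    by (rule measurable_distr2[OF _ kernel_measurable_subprob]) (simp add: case_prod_unfold pair_id_measurable)
  have ne: "space \<mu> \<noteq> {}" by (rule not_empty)
  have setsK: "sets (\<mu> \<bind> ?k) = sets ?N" by (rule sets_bind[OF _ ne]) simp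
  have sp: "S \<in> sets (sigma_off S i)" using sets.top[of "sigma_off S i"] by simp
  show ?thesis
  proof (rule measure_eqI_generator_eq[of ?E "S \<times> UNIV" _ _ "\<lambda>_. S \<times> UNIV"])
    show "Int_stable ?E" by (rule Int_stable_pair_measure_generator)
    show "?E \<subseteq> Pow (S \<times> UNIV)" using sets.sets_into_space[of _ "sigma_off S i"] by auto
    show "sets ?D = sigma_sets (S \<times> UNIV) ?E" by (simp add: sets_pair_measure)
    show "sets (\<mu> \<bind> ?k) = sigma_sets (S \<times> UNIV) ?E" by (simp add: setsK sets_pair_measure)
    show "range (\<lambda>_. S \<times> UNIV) \<subseteq> ?E" 
    proof (rule image_subsetI)
      show "S \<times> UNIV \<in> ?E"
        by (rule CollectI, rule exI[of _ S], rule exI[of _ UNIV]) (simp add: sp)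
    qed
    interpret D: prob_space ?D by (rule prob_space_distr[OF pm])
    show "emeasure ?D (S \<times> UNIV) \<noteq> \<infinity>" using D.emeasure_finite[of "S \<times> UNIV"] by simp
    fix X assume "X \<in> ?E"
    then obtain A B where X: "X = A \<times> B" and A: "A \<in> sets (sigma_off S i)" and B: "B \<in> sets borel" by auto
    have XN: "X \<in> sets ?N" using A B by (simp add: X)
    have AS: "A \<subseteq> S" using sets.sets_into_space[OF A] by simp
    have "emeasure ?D X = emeasure \<mu> ({x \<in> S. x i \<in> B} \<inter> A)"
      using emeasure_distr[OF pm XN] AS by (simp add: X) (rule arg_cong[where f="emeasure \<mu>"], auto)
    also have "\<dots> = (\<integral>\<^sup>+x\<in>A. emeasure (\<kappa> i x) B \<partial>\<mu>)"
      using conjunct2[OF cond[of i, unfolded cond_dist_def]] A B by blast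
    also have "\<dots> = (\<integral>\<^sup>+x. emeasure (?k x) X \<partial>\<mu>)"
    proof (rule nn_integral_cong)
      fix x assume x: "x \<in> space \<mu>"
      have m: "(\<lambda>y. (x, y)) \<in> measurable (\<kappa> i x) ?N"
        using x by (simp add: measurable_cong_sets[OF kernel_props(2) refl])
      show "emeasure (\<kappa> i x) B * indicator A x = emeasure (?k x) X"
        using emeasure_distr[OF m XN] kernel_props[of x i] x
        by (cases "x \<in> A") (auto simp: X vimage_def)
    qed
    also have "\<dots> = emeasure (\<mu> \<bind> ?k) X" by (rule emeasure_bind[OF ne k XN, symmetric])
    finally show "emeasure ?D X = emeasure (\<mu> \<bind> ?k) X" .
  qed auto
qed

lemma disintegration:
  assumes F: "F \<in> borel_measurable (sigma_off S i \<Otimes>\<^sub>M borel)"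
  shows "(\<integral>\<^sup>+x. F (x, x i) \<partial>\<mu>) = (\<integral>\<^sup>+x. \<integral>\<^sup>+y. F (x, y) \<partial>\<kappa> i x \<partial>\<mu>)"
proof -
  let ?N = "sigma_off S i \<Otimes>\<^sub>M (borel :: real measure)"
  let ?k = "\<lambda>x. distr (\<kappa> i x) ?N (\<lambda>y. (x, y))"
  have pm: "(\<lambda>x. (x, x i)) \<in> measurable \<mu> ?N"
    by (intro measurable_Pair id_measurable_sigma_off coordinate_measurable)
  have k: "?k \<in> measurable \<mu> (subprob_algebra ?N)"
    by (rule measurable_distr2[OF _ kernel_measurable_subprob]) (simp add: case_prod_unfold pair_id_measurable)
  have "(\<integral>\<^sup>+x. F (x, x i) \<partial>\<mu>) = integral\<^sup>N (distr \<mu> ?N (\<lambda>x. (x, x i))) F"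
    using F pm by (simp add: nn_integral_distr)
  also have "\<dots> = (\<integral>\<^sup>+x. integral\<^sup>N (?k x) F \<partial>\<mu>)"
    unfolding disintegration_measure by (rule nn_integral_bind[OF F k])
  also have "\<dots> = (\<integral>\<^sup>+x. \<integral>\<^sup>+y. F (x, y) \<partial>\<kappa> i x \<partial>\<mu>)"
  proof (rule nn_integral_cong)
    fix x assume x: "x \<in> space \<mu>"
    have m: "(\<lambda>y. (x, y)) \<in> measurable (\<kappa> i x) ?N"
      using x by (simp add: measurable_cong_sets[OF kernel_props(2) refl])
    show "integral\<^sup>N (?k x) F = (\<integral>\<^sup>+y. F (x, y) \<partial>\<kappa> i x)" using F by (simp add: nn_integral_distr[OF m])
  qed
  finally show ?thesis .
qed

text \<open>Cylinder functions are continuous for the product topology; composition with this map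
  makes them measurable for \<open>\<mu>\<close>.\<close>

lemma id_measurable_borel: "(\<lambda>x. x) \<in> measurable \<mu> (borel :: seq measure)"
  by (rule measurable_coordinatewise_then_product) (rule coordinate_measurable)

lemma AE_update:
  assumes P: "{z :: seq. P z} \<in> sets borel" and ae: "AE x in \<mu>. P x"
  shows "AE x in \<mu>. AE y in \<kappa> i x. P (x(i := y))"
proof -
  define F :: "seq \<times> real \<Rightarrow> ennreal" where "F p = indicator {z. \<not> P z} (case p of (x, y) \<Rightarrow> x(i := y))" for p
  have ind: "(indicator {z. \<not> P z} :: seq \<Rightarrow> ennreal) \<in> borel_measurable borel"
  proof -
    have "- {z. P z} \<in> sets borel" using P by (rule borel_comp)
    then show ?thesis by (simp add: Collect_neg_eq)
  qed
  have F: "F \<in> borel_measurable (sigma_off S i \<Otimes>\<^sub>M borel)"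
    unfolding F_def by (rule measurable_compose[OF update_measurable_sigma_off ind])
  \<comment> \<open>Since \<open>x(i := x i) = x\<close>, the left side of the disintegration is the
    measure of the exceptional set.\<close>
  have "(\<integral>\<^sup>+x. F (x, x i) \<partial>\<mu>) = (\<integral>\<^sup>+x. 0 \<partial>\<mu>)"
    by (rule nn_integral_cong_AE) (use ae in \<open>auto simp: F_def elim!: eventually_mono\<close>)
  then have 0: "(\<integral>\<^sup>+x. \<integral>\<^sup>+y. F (x, y) \<partial>\<kappa> i x \<partial>\<mu>) = 0"
    using disintegration[OF F] by simp
  have F2: "(\<lambda>(x, y). F (x, y)) \<in> borel_measurable (\<mu> \<Otimes>\<^sub>M borel)"
    using measurable_compose[OF pair_id_measurable F] by simp
  have "AE x in \<mu>. x \<in> space \<mu> \<and> (\<integral>\<^sup>+y. F (x, y) \<partial>\<kappa> i x) = 0"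
    using 0 nn_integral_measurable_subprob_algebra2[OF F2 kernel_measurable_subprob[of i]]
    by (subst (asm) nn_integral_0_iff_AE) auto
  moreover have *: "AE y in \<kappa> i x. P (x(i := y))" if x: "x \<in> space \<mu>" and z: "(\<integral>\<^sup>+y. F (x, y) \<partial>\<kappa> i x) = 0" for x
  proof -
    have "(\<lambda>y. (x, y)) \<in> measurable (\<kappa> i x) (sigma_off S i \<Otimes>\<^sub>M borel)"
      using x by (simp add: measurable_cong_sets[OF kernel_props(2) refl])
    from measurable_compose[OF this F] have "(\<lambda>y. F (x, y)) \<in> borel_measurable (\<kappa> i x)" .
    then have "AE y in \<kappa> i x. F (x, y) = 0" using z by (simp add: nn_integral_0_iff_AE)
    then show ?thesis by (rule eventually_mono) (auto simp: F_def indicator_def split: if_splits)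
  qed
  ultimately show ?thesis by (rule eventually_mono) auto
qed

end

section \<open>Smooth functions\<close>

text \<open>The derivative is a witness instead of \<open>deriv\<close>, so that the closure lemmas
  can feed derivative rules directly into the induction. Smoothness is \<open>Ck_real k\<close> for
  every \<open>k\<close>.\<close>

primrec Ck_real :: "nat \<Rightarrow> (real \<Rightarrow> real) \<Rightarrow> bool" where
  "Ck_real 0 f \<longleftrightarrow> continuous_on UNIV f"
| "Ck_real (Suc k) f \<longleftrightarrow> (\<exists>f'. (\<forall>t. (f has_real_derivative f' t) (at t)) \<and> Ck_real k f')"

lemma Ck_real_mono: "Ck_real (Suc k) f \<Longrightarrow> Ck_real k f"
proof (induction k arbitrary: f)
  case 0
  then show ?case by (auto intro!: continuous_at_imp_continuous_on intro: DERIV_isCont)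
next
  case (Suc k)
  then show ?case by (metis Ck_real.simps(2))
qed

lemma Ck_real_const: "Ck_real k (\<lambda>_. c)"
  by (induction k arbitrary: c) (auto intro!: exI[of _ "\<lambda>_. 0"] derivative_eq_intros)

lemma Ck_real_affine: "Ck_real k (\<lambda>t. a * t + b)"
proof (cases k)
  case (Suc m)
  then show ?thesis by (auto intro!: exI[of _ "\<lambda>_. a"] derivative_eq_intros Ck_real_const)
qed (auto intro!: continuous_intros)

lemma Ck_real_SucE:
  assumes "Ck_real (Suc k) f"
  obtains f' where "\<And>t. (f has_real_derivative f' t) (at t)" "Ck_real k f'"
  using assms unfolding Ck_real.simps by blast

lemma Ck_real_SucI:
  assumes "\<And>t. (f has_real_derivative f' t) (at t)" "Ck_real k f'"
  shows "Ck_real (Suc k) f"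
  using assms unfolding Ck_real.simps by blast

lemma Ck_real_add: "Ck_real k f \<Longrightarrow> Ck_real k g \<Longrightarrow> Ck_real k (\<lambda>t. f t + g t)"
proof (induction k arbitrary: f g)
  case (Suc k)
  obtain f' where f': "\<And>t. (f has_real_derivative f' t) (at t)" "Ck_real k f'"
    using Suc.prems(1) by (rule Ck_real_SucE) blast
  obtain g' where g': "\<And>t. (g has_real_derivative g' t) (at t)" "Ck_real k g'"
    using Suc.prems(2) by (rule Ck_real_SucE) blast
  show ?case by (rule Ck_real_SucI[OF DERIV_add[OF f'(1) g'(1)] Suc.IH[OF f'(2) g'(2)]])
qed (simp add: continuous_on_add)

lemma Ck_real_mult: "Ck_real k f \<Longrightarrow> Ck_real k g \<Longrightarrow> Ck_real k (\<lambda>t. f t * g t)"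
proof (induction k arbitrary: f g)
  case (Suc k)
  obtain f' where f': "\<And>t. (f has_real_derivative f' t) (at t)" "Ck_real k f'"
    using Suc.prems(1) by (rule Ck_real_SucE) blast
  obtain g' where g': "\<And>t. (g has_real_derivative g' t) (at t)" "Ck_real k g'"
    using Suc.prems(2) by (rule Ck_real_SucE) blast
  show ?case
    by (rule Ck_real_SucI[OF DERIV_mult[OF f'(1) g'(1)]])
       (intro Ck_real_add Suc.IH f' g' Suc.prems[THEN Ck_real_mono])
qed (simp add: continuous_on_mult)

lemma Ck_real_compose: "Ck_real k f \<Longrightarrow> Ck_real k g \<Longrightarrow> Ck_real k (\<lambda>t. f (g t))"
proof (induction k arbitrary: f g)
  case 0
  then show ?case by (auto intro: continuous_on_compose2)
next
  case (Suc k)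
  obtain f' where f': "\<And>t. (f has_real_derivative f' t) (at t)" "Ck_real k f'"
    using Suc.prems(1) by (rule Ck_real_SucE) blast
  obtain g' where g': "\<And>t. (g has_real_derivative g' t) (at t)" "Ck_real k g'"
    using Suc.prems(2) by (rule Ck_real_SucE) blast
  show ?case
    by (rule Ck_real_SucI[OF DERIV_chain2[OF f'(1) g'(1)]])
       (rule Ck_real_mult[OF Suc.IH[OF f'(2) Ck_real_mono[OF Suc.prems(2)]] g'(2)])
qed

text \<open>The derivative of \<open>P(1/t) e\<^sup>-\<^sup>1\<^sup>/\<^sup>t\<close> is again of this form, which gives smoothness at 0.\<close>

definition flat :: "real poly \<Rightarrow> real \<Rightarrow> real" where
  "flat P t = (if 0 < t then poly P (1 / t) * exp (- (1 / t)) else 0)"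

lemma poly_times_exp_minus_tendsto_0: "((\<lambda>s::real. poly P s * exp (- s)) \<longlongrightarrow> 0) at_top"
proof -
  have "((\<lambda>s::real. \<Sum>i\<le>degree P. coeff P i * (s ^ i / exp s)) \<longlongrightarrow> (\<Sum>i\<le>degree P. coeff P i * 0)) at_top"
    by (intro tendsto_sum tendsto_mult tendsto_const tendsto_power_div_exp_0)
  moreover have "(\<lambda>s::real. \<Sum>i\<le>degree P. coeff P i * (s ^ i / exp s)) = (\<lambda>s. poly P s * exp (- s))"
    by (simp add: poly_altdef sum_distrib_right exp_minus divide_inverse mult.assoc)
  ultimately show ?thesis by simp
qed

text \<open>With s = 1/t and ds/dt = -s^2, differentiating P(s) exp(-s) gives s^2 (P - P')(s)
  exp(-s); \<open>[:0, 0, 1:]\<close> is the factor s^2.\<close>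

lemma flat_has_derivative:
  "(flat P has_real_derivative flat ([:0, 0, 1:] * (P - pderiv P)) t) (at t)"
proof -
  consider "t < 0" | "t = 0" | "0 < t" by linarith
  then show ?thesis
  proof cases
    case 1
    have "((\<lambda>_. 0) has_real_derivative 0) (at t)" by simp
    then have "(flat P has_real_derivative 0) (at t)"
      by (rule has_field_derivative_transform_within_open[of _ _ _ "{..<0}"]) (use 1 in \<open>auto simp: flat_def\<close>)
    then show ?thesis using 1 by (simp add: flat_def)
  next
    case 2
    \<comment> \<open>With s = 1/h the right difference quotient at 0 is s P(s) exp(-s);
      \<open>pCons 0\<close> is the factor s.\<close>
    have "((\<lambda>h. poly (pCons 0 P) (inverse h) * exp (- inverse h)) \<longlongrightarrow> 0) (at_right (0::real))"
      by (rule filterlim_compose[OF poly_times_exp_minus_tendsto_0 filterlim_inverse_at_top_right])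
    then have r: "((\<lambda>h. flat P h / h) \<longlongrightarrow> 0) (at_right 0)"
      by (rule Lim_transform_eventually)
         (auto simp: eventually_at_right_field flat_def field_simps intro!: exI[of _ 1])
    have l: "((\<lambda>h. flat P h / h) \<longlongrightarrow> 0) (at_left 0)"
      by (rule Lim_transform_eventually[OF tendsto_const])
         (auto simp: eventually_at_left_field flat_def intro!: exI[of _ "-1"])
    show ?thesis using filterlim_split_at[OF l r] 2 by (simp add: has_field_derivative_iff flat_def)
  next
    case 3
    have "((\<lambda>t. poly P (1 / t) * exp (- (1 / t))) has_real_derivative
        flat ([:0, 0, 1:] * (P - pderiv P)) t) (at t)"
      using 3 by (auto intro!: derivative_eq_intros simp: flat_def power2_eq_square field_simps)
    then show ?thesis
      by (rule has_field_derivative_transform_within_open[of _ _ _ "{0<..}"]) (use 3 in \<open>auto simp: flat_def\<close>)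
  qed
qed

lemma Ck_real_flat: "Ck_real k (flat P)"
proof (induction k arbitrary: P)
  case 0
  show ?case
    by (auto intro!: continuous_at_imp_continuous_on DERIV_isCont[OF flat_has_derivative])
next
  case (Suc k)
  then show ?case using flat_has_derivative by auto
qed

lemma flat_1_mono: "s \<le> t \<Longrightarrow> flat 1 s \<le> flat 1 t"
  by (auto simp: flat_def field_simps)

lemma flat_1_nonneg [simp]: "0 \<le> flat 1 t" and flat_1_pos: "0 < t \<Longrightarrow> 0 < flat 1 t"
  by (auto simp: flat_def)

text \<open>A smooth step from 1 on \<open>t \<le> 0\<close> down to 0 on
  \<open>\<epsilon> \<le> t\<close>. Nesting \<open>flat\<close> keeps the denominator constant,
  whereas the usual quotient f(\<epsilon> - t) / (f(\<epsilon> - t) + f(t)) would call for closure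
  of \<open>Ck_real\<close> under division.\<close>

definition cutoff :: "real \<Rightarrow> real \<Rightarrow> real" where
  "cutoff \<epsilon> t = flat 1 (flat 1 \<epsilon> - flat 1 t) / flat 1 (flat 1 \<epsilon>)"

lemma Ck_real_cutoff: "Ck_real k (cutoff \<epsilon>)"
proof -
  have "Ck_real k (\<lambda>t. (1 / flat 1 (flat 1 \<epsilon>)) * flat 1 ((-1) * flat 1 t + flat 1 \<epsilon>) + 0)"
    by (rule Ck_real_compose[OF Ck_real_affine Ck_real_compose[OF Ck_real_flat
          Ck_real_compose[OF Ck_real_affine Ck_real_flat]]])
  then show ?thesis by (simp add: cutoff_def[abs_def])
qed

lemma cutoff_bounds:
  assumes "0 < \<epsilon>"
  shows "0 \<le> cutoff \<epsilon> t" "cutoff \<epsilon> t \<le> 1" "t \<le> 0 \<Longrightarrow> cutoff \<epsilon> t = 1" "\<epsilon> \<le> t \<Longrightarrow> cutoff \<epsilon> t = 0"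
proof -
  have p: "0 < flat 1 (flat 1 \<epsilon>)" using assms by (intro flat_1_pos)
  show "0 \<le> cutoff \<epsilon> t" using p by (simp add: cutoff_def)
  show "cutoff \<epsilon> t \<le> 1" using p by (auto simp: cutoff_def divide_le_eq intro!: flat_1_mono)
  show "cutoff \<epsilon> t = 1" if "t \<le> 0" using p that by (simp add: cutoff_def flat_def)
  show "cutoff \<epsilon> t = 0" if "\<epsilon> \<le> t" using flat_1_mono[OF that] by (simp add: cutoff_def flat_def)
qed

text \<open>The truncation is the primitive, zero at 0, of a smooth plateau \<open>h\<close> that
  equals 1 on [0, 1], vanishes outside [-\<epsilon>, 1 + \<epsilon>] and lies between 0 and 1. The
  bounds on the slope give monotonicity and contraction; the two ramps have length \<epsilon>, so
  the overshoot on each side is at most \<epsilon>.\<close>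

lemma smooth_truncation:
  fixes \<epsilon> :: real
  assumes "0 < \<epsilon>"
  obtains \<phi> :: "real \<Rightarrow> real" where "\<And>k. Ck_real k \<phi>" "\<And>t. t \<in> {0..1} \<Longrightarrow> \<phi> t = t"
    "\<And>t. - \<epsilon> \<le> \<phi> t \<and> \<phi> t \<le> 1 + \<epsilon>" "\<And>s t. s < t \<Longrightarrow> 0 \<le> \<phi> t - \<phi> s \<and> \<phi> t - \<phi> s \<le> t - s"
proof -
  \<comment> \<open>A reflected step times a shifted one; the arguments are spelt
    \<open>a * t + b\<close> to match \<open>Ck_real_affine\<close>.\<close>
  define h where "h t = cutoff \<epsilon> ((-1) * t + 0) * cutoff \<epsilon> (1 * t + (-1))" for t
  have smooth: "Ck_real k h" for k
    unfolding h_def by (intro Ck_real_mult Ck_real_compose[OF Ck_real_cutoff] Ck_real_affine)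
  have h: "0 \<le> h t" "h t \<le> 1" "0 \<le> t \<Longrightarrow> t \<le> 1 \<Longrightarrow> h t = 1" "t \<le> - \<epsilon> \<Longrightarrow> h t = 0" "1 + \<epsilon> \<le> t \<Longrightarrow> h t = 0" for t
    using cutoff_bounds[OF assms] by (auto simp: h_def intro!: mult_nonneg_nonneg mult_le_one)
  have "continuous_on UNIV h" using smooth[of 0] by simp
  \<comment> \<open>Infinite endpoints in \<open>einterval_antiderivative\<close> yield one
    primitive on the whole line, on both sides of 0.\<close>
  then have "\<exists>F. \<forall>x. - \<infinity> < ereal x \<longrightarrow> ereal x < \<infinity> \<longrightarrow> (F has_vector_derivative h x) (at x)"
    by (intro einterval_antiderivative) (auto simp: continuous_on_eq_continuous_at)
  then obtain F where F: "\<And>x. (F has_real_derivative h x) (at x)"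
    by (auto simp: has_real_derivative_iff_has_vector_derivative)
  define \<phi> where "\<phi> t = F t - F 0" for t
  have d: "(\<phi> has_real_derivative h x) (at x)" for x
    unfolding \<phi>_def by (auto intro!: derivative_eq_intros F)
  have mvt: "\<exists>z. s < z \<and> z < t \<and> \<phi> t - \<phi> s = (t - s) * h z" if "s < t" for s t
    using MVT2[OF that, of \<phi> h] d by blast
  have 0: "\<phi> 0 = 0" by (simp add: \<phi>_def)
  have lip: "0 \<le> \<phi> t - \<phi> s \<and> \<phi> t - \<phi> s \<le> t - s" if st: "s < t" for s t
  proof -
    obtain z where z: "\<phi> t - \<phi> s = (t - s) * h z" using mvt[OF st] by blast
    show ?thesis using st h(1,2)[of z] by (simp add: z mult_left_le)
  qed
  show thesis
  proof (rule that)
    show "Ck_real k \<phi>" for k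
    proof (cases k)
      case 0 then show ?thesis by (auto intro!: continuous_at_imp_continuous_on DERIV_isCont[OF d])
    next
      case (Suc m) then show ?thesis using d smooth by auto
    qed
    show "\<phi> t = t" if t: "t \<in> {0..1}" for t
    proof (cases "t = 0")
      case False
      then obtain z where "0 < z" "z < t" "\<phi> t - \<phi> 0 = (t - 0) * h z" using mvt[of 0 t] t by auto
      then show ?thesis using t 0 h(3)[of z] by simp
    qed (simp add: 0)
    show "- \<epsilon> \<le> \<phi> t \<and> \<phi> t \<le> 1 + \<epsilon>" for t
    proof -
      consider "t < - \<epsilon>" | "- \<epsilon> \<le> t" "t < 0" | "t = 0" | "0 < t" "t \<le> 1 + \<epsilon>" | "1 + \<epsilon> < t" by linarith
      then show ?thesis
      proof cases
        case 1
        obtain z where "t < z" "z < - \<epsilon>" "\<phi> (- \<epsilon>) - \<phi> t = (- \<epsilon> - t) * h z" using mvt[OF 1] by blast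
        then have "\<phi> t = \<phi> (- \<epsilon>)" using h(4)[of z] by simp
        then show ?thesis using lip[of "- \<epsilon>" 0] assms 0 by simp
      next
        case 2 then show ?thesis using lip[of t 0] assms 0 by simp
      next
        case 3 then show ?thesis using assms 0 by simp
      next
        case 4 then show ?thesis using lip[of 0 t] assms 0 by simp
      next
        case 5
        obtain z where "1 + \<epsilon> < z" "z < t" "\<phi> t - \<phi> (1 + \<epsilon>) = (t - (1 + \<epsilon>)) * h z" using mvt[OF 5] by blast
        then have "\<phi> t = \<phi> (1 + \<epsilon>)" using h(5)[of z] by simp
        then show ?thesis using lip[of 0 "1 + \<epsilon>"] assms 0 by simp
      qed
    qed
  qed (rule lip)
qed

section \<open>Closure properties of \<open>C_k\<close>\<close>

lemma C_k_continuous: "C_k n k f \<Longrightarrow> continuous_on UNIV f"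
  by (cases k) auto

lemma C_k_mono: "C_k n (Suc k) f \<Longrightarrow> C_k n k f"
proof (induction k arbitrary: f)
  case (Suc k)
  then show ?case by (metis C_k.simps(2))
qed simp

lemma partial_deriv_works:
  assumes "(\<lambda>t. f (x(j := t))) differentiable (at (x j))"
  shows "((\<lambda>t. f (x(j := t))) has_real_derivative partial_deriv j f x) (at (x j))"
  using assms by (simp add: partial_deriv_def DERIV_deriv_iff_real_differentiable)

lemma partial_derivI:
  "((\<lambda>t. f (x(j := t))) has_real_derivative D) (at (x j)) \<Longrightarrow> partial_deriv j f x = D"
  by (simp add: partial_deriv_def DERIV_imp_deriv)

text \<open>By uniqueness of derivatives \<open>partial_deriv j f\<close> and \<open>D j\<close> are
  the same function, so the closure proofs can name the derivative and never evaluate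
  \<open>deriv\<close>.\<close>

lemma C_k_SucI:
  assumes "continuous_on UNIV f"
    and "\<And>j x. j < n \<Longrightarrow> ((\<lambda>t. f (x(j := t))) has_real_derivative D j x) (at (x j))"
    and "\<And>j. j < n \<Longrightarrow> C_k n k (D j)"
  shows "C_k n (Suc k) f"
proof -
  have "partial_deriv j f = D j" if "j < n" for j
    by (rule ext, rule partial_derivI, rule assms(2)[OF that])
  then show ?thesis using assms by (auto simp: real_differentiable_def)
qed

lemma C_k_SucD:
  assumes "C_k n (Suc k) f" "j < n"
  shows "((\<lambda>t. f (x(j := t))) has_real_derivative partial_deriv j f x) (at (x j))" "C_k n k (partial_deriv j f)"
  using assms partial_deriv_works by auto

lemma C_k_add: "C_k n k f \<Longrightarrow> C_k n k g \<Longrightarrow> C_k n k (\<lambda>x. f x + g x)"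
proof (induction k arbitrary: f g)
  case (Suc k)
  show ?case
    by (rule C_k_SucI[where D="\<lambda>j x. partial_deriv j f x + partial_deriv j g x"])
       (intro continuous_on_add DERIV_add Suc.IH C_k_continuous[OF Suc.prems(1)] C_k_continuous[OF Suc.prems(2)]
          C_k_SucD[OF Suc.prems(1)] C_k_SucD[OF Suc.prems(2)]; assumption)+
qed (auto intro: continuous_on_add)

lemma C_k_mult: "C_k n k f \<Longrightarrow> C_k n k g \<Longrightarrow> C_k n k (\<lambda>x. f x * g x)"
proof (induction k arbitrary: f g)
  case (Suc k)
  show ?case
  proof (rule C_k_SucI[where D="\<lambda>j x. partial_deriv j f x * g x + partial_deriv j g x * f x"])
    show "continuous_on UNIV (\<lambda>x. f x * g x)"
      by (intro continuous_on_mult C_k_continuous[OF Suc.prems(1)] C_k_continuous[OF Suc.prems(2)])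
    fix j x assume j: "j < n"
    show "((\<lambda>t. f (x(j := t)) * g (x(j := t))) has_real_derivative partial_deriv j f x * g x + partial_deriv j g x * f x) (at (x j))"
      by (rule DERIV_cong[OF DERIV_mult[OF C_k_SucD(1)[OF Suc.prems(1) j] C_k_SucD(1)[OF Suc.prems(2) j]]]) simp
    show "C_k n k (\<lambda>x. partial_deriv j f x * g x + partial_deriv j g x * f x)"
      by (intro C_k_add Suc.IH C_k_SucD(2)[OF Suc.prems(1) j] C_k_SucD(2)[OF Suc.prems(2) j]
           C_k_mono[OF Suc.prems(1)] C_k_mono[OF Suc.prems(2)])
  qed
qed (auto intro: continuous_on_mult)

lemma C_k_compose: "Ck_real k \<phi> \<Longrightarrow> C_k n k f \<Longrightarrow> C_k n k (\<lambda>x. \<phi> (f x))"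
proof (induction k arbitrary: \<phi> f)
  case 0
  then show ?case by (auto intro: continuous_on_compose2)
next
  case (Suc k)
  obtain \<phi>' where \<phi>': "\<And>t. (\<phi> has_real_derivative \<phi>' t) (at t)" "Ck_real k \<phi>'"
    using Suc.prems(1) by (rule Ck_real_SucE) blast
  have cont: "continuous_on UNIV \<phi>" by (auto intro!: continuous_at_imp_continuous_on DERIV_isCont[OF \<phi>'(1)])
  show ?case
  proof (rule C_k_SucI[where D="\<lambda>j x. \<phi>' (f x) * partial_deriv j f x"])
    show "continuous_on UNIV (\<lambda>x. \<phi> (f x))"
      by (rule continuous_on_compose2[OF cont C_k_continuous[OF Suc.prems(2)]]) simp
    fix j x assume j: "j < n"
    show "((\<lambda>t. \<phi> (f (x(j := t)))) has_real_derivative \<phi>' (f x) * partial_deriv j f x) (at (x j))"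
      by (rule DERIV_chain2[OF _ C_k_SucD(1)[OF Suc.prems(2) j]]) (simp add: \<phi>'(1))
    show "C_k n k (\<lambda>x. \<phi>' (f x) * partial_deriv j f x)"
      by (rule C_k_mult[OF Suc.IH[OF \<phi>'(2) C_k_mono[OF Suc.prems(2)]] C_k_SucD(2)[OF Suc.prems(2) j]])
  qed
qed

section \<open>Smooth cylinder functions with compact support\<close>

lemma C0_infinityD:
  assumes "f \<in> C0_infinity n"
  shows "depends_on_first n f" "C_k n k f" "\<exists>R. \<forall>x. f x \<noteq> 0 \<longrightarrow> (\<forall>i<n. \<bar>x i\<bar> \<le> R)"
  using assms unfolding C0_infinity_def by blast+

lemma FC_compose:
  assumes \<phi>: "\<And>k. Ck_real k \<phi>" "\<phi> 0 = 0" and u: "u \<in> FC"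
  shows "\<phi> \<circ> u \<in> FC"
proof -
  obtain n where n: "1 \<le> n" "u \<in> C0_infinity n" using u by (auto simp: FC_def)
  obtain R where R: "\<And>x. u x \<noteq> 0 \<Longrightarrow> \<forall>i<n. \<bar>x i\<bar> \<le> R"
    using C0_infinityD(3)[OF n(2)] by blast
  have "depends_on_first n (\<phi> \<circ> u)"
    unfolding depends_on_first_def
  proof (intro allI impI)
    fix x y :: seq assume "\<forall>i<n. x i = y i"
    then have "u x = u y" using C0_infinityD(1)[OF n(2)] unfolding depends_on_first_def by blast
    then show "(\<phi> \<circ> u) x = (\<phi> \<circ> u) y" by simp
  qed
  moreover have "\<forall>k. C_k n k (\<phi> \<circ> u)"
    unfolding o_def by (rule allI, rule C_k_compose[OF \<phi>(1) C0_infinityD(2)[OF n(2)]])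
  \<comment> \<open>Where \<open>u\<close> vanishes the composition has the value
    \<open>\<phi> 0 = 0\<close>, so the same \<open>R\<close> serves.\<close>
  moreover have "\<forall>x. (\<phi> \<circ> u) x \<noteq> 0 \<longrightarrow> (\<forall>i<n. \<bar>x i\<bar> \<le> R)"
  proof (rule allI, rule impI)
    fix x assume "(\<phi> \<circ> u) x \<noteq> 0"
    then have "u x \<noteq> 0" using \<phi>(2) by (cases "u x = 0") auto
    then show "\<forall>i<n. \<bar>x i\<bar> \<le> R" by (rule R)
  qed
  ultimately have "\<phi> \<circ> u \<in> C0_infinity n" unfolding C0_infinity_def by blast
  then show ?thesis using n unfolding FC_def by auto
qed

text \<open>The cube in the first \<open>n\<close> coordinates, continued by 0, is compact by
  Tychonoff. Setting the later coordinates to 0 does not change \<open>g\<close>, and this moves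
  every point with \<open>g x \<noteq> 0\<close> into that set.\<close>

lemma bounded_if_compact_support:
  assumes dep: "depends_on_first n g" and cont: "continuous_on UNIV g"
    and supp: "\<And>x. g x \<noteq> 0 \<Longrightarrow> \<forall>i<n. \<bar>x i\<bar> \<le> R"
  shows "\<exists>B. \<forall>x. \<bar>g x\<bar> \<le> B"
proof -
  let ?K = "\<Pi>\<^sub>E i\<in>UNIV. if i < n then {-R..R} else {0::real}"
  have "compactin (product_topology (\<lambda>i::nat. euclidean :: real topology) UNIV) ?K"
    by (subst compactin_PiE) auto
  then have "compact ?K" by (simp add: euclidean_product_topology)
  then have "compact (g ` ?K)" using cont by (intro compact_continuous_image continuous_on_subset[OF cont]) auto
  then obtain B where B: "\<And>x. x \<in> ?K \<Longrightarrow> \<bar>g x\<bar> \<le> B"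
    by (metis bounded_real compact_imp_bounded image_eqI)
  have "\<bar>g x\<bar> \<le> max B 0" for x
  proof (cases "g x = 0")
    case False
    let ?x = "\<lambda>i. if i < n then x i else 0"
    have "?x \<in> ?K" using supp[OF False] by (auto simp: PiE_iff abs_le_iff minus_le_iff)
    moreover have "g ?x = g x" using dep unfolding depends_on_first_def by (elim allE impE) auto
    ultimately show ?thesis using B[of ?x] by simp
  qed simp
  then show ?thesis by blast
qed

lemma depends_on_first_partial_deriv:
  assumes "depends_on_first n f"
  shows "depends_on_first n (partial_deriv j f)"
proof (cases "j < n")
  case True
  show ?thesis unfolding depends_on_first_def
  proof (intro allI impI)
    fix x y :: seq assume xy: "\<forall>i<n. x i = y i"
    have "(\<lambda>t. f (x(j := t))) = (\<lambda>t. f (y(j := t)))"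
      using assms xy unfolding depends_on_first_def by (intro ext) simp
    then show "partial_deriv j f x = partial_deriv j f y" using xy True by (simp add: partial_deriv_def)
  qed
next
  case False
  have "partial_deriv j f x = 0" for x
  proof -
    have "(\<lambda>t. f (x(j := t))) = (\<lambda>t. f x)"
      using assms False unfolding depends_on_first_def by (intro ext) (elim allE impE, auto)
    then show ?thesis by (simp add: partial_deriv_def)
  qed
  then show ?thesis by (simp add: depends_on_first_def)
qed

text \<open>At a point outside the cube \<open>f\<close> vanishes along direction \<open>j\<close>:
  on the whole line if another coordinate exceeds \<open>R\<close>, and on the open set
  \<open>R < \<bar>t\<bar>\<close> if coordinate \<open>j\<close> does. Either way the derivative is
  0.\<close>

lemma partial_deriv_support:
  assumes supp: "\<And>x. f x \<noteq> 0 \<Longrightarrow> \<forall>i<n. \<bar>x i\<bar> \<le> R" and nz: "partial_deriv j f x \<noteq> 0"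
  shows "\<forall>i<n. \<bar>x i\<bar> \<le> R"
proof (rule ccontr)
  assume "\<not> ?thesis"
  then obtain i where i: "i < n" "R < \<bar>x i\<bar>" by auto
  have "((\<lambda>t. f (x(j := t))) has_real_derivative 0) (at (x j))"
  proof (cases "i = j")
    case False
    have "f (x(j := t)) = 0" for t using supp[of "x(j := t)"] i False by force
    then show ?thesis by simp
  next
    case True
    have op: "open {t::real. R < \<bar>t\<bar>}" by (intro open_Collect_less continuous_intros)
    have "f (x(j := t)) = 0" if "R < \<bar>t\<bar>" for t using supp[of "x(j := t)"] i True that by force
    then show ?thesis
      using i True
      by (intro has_field_derivative_transform_within_open[OF DERIV_const[of 0] op]) auto
  qed
  then show False using nz partial_derivI by blast
qed

text \<open>The mean value inequality along coordinate \<open>i\<close>. The partial derivative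
  inherits continuity, finite dependence and bounded support, hence is bounded, and \<open>M\<close>
  is uniform in all the other coordinates.\<close>

lemma C0_infinity_lipschitz:
  assumes f: "f \<in> C0_infinity n"
  shows "\<exists>M. \<forall>x y y'. \<bar>f (x(i := y)) - f (x(i := y'))\<bar> \<le> M * \<bar>y - y'\<bar>"
proof (cases "i < n")
  case True
  obtain R where R: "\<And>x. f x \<noteq> 0 \<Longrightarrow> \<forall>i<n. \<bar>x i\<bar> \<le> R"
    using C0_infinityD(3)[OF f] by blast
  note dep = C0_infinityD(1)[OF f] and Ck = C0_infinityD(2)[OF f, of "Suc 0"]
  have "\<forall>j<n. \<bar>x j\<bar> \<le> R" if "partial_deriv i f x \<noteq> 0" for x
    by (rule partial_deriv_support[OF R that])
  then obtain M where M: "\<And>x. \<bar>partial_deriv i f x\<bar> \<le> M"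
    using bounded_if_compact_support[OF depends_on_first_partial_deriv[OF dep]
        C_k_continuous[OF C_k_SucD(2)[OF Ck True]]] by blast
  have "\<bar>f (x(i := y)) - f (x(i := y'))\<bar> \<le> M * \<bar>y - y'\<bar>" for x y y'
  proof -
    have d: "((\<lambda>s. f (x(i := s))) has_real_derivative partial_deriv i f (x(i := t))) (at t within UNIV)" for t
      using C_k_SucD(1)[OF Ck True, of "x(i := t)"] by simp
    show ?thesis
      using field_differentiable_bound[OF convex_UNIV d, of M y' y] M by (simp add: abs_minus_commute)
  qed
  then show ?thesis by blast
next
  case False
  have "f (x(i := y)) = f (x(i := y'))" for x y y'
    using C0_infinityD(1)[OF f] False unfolding depends_on_first_def by (elim allE impE) auto
  then show ?thesis by (intro exI[of _ 0]) simp
qed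

section \<open>The energy\<close>

lemma FC_props:
  assumes "u \<in> FC"
  obtains n B R where "depends_on_first n u" "\<And>x. \<bar>u x\<bar> \<le> B"
    "\<And>x. u x \<noteq> 0 \<Longrightarrow> \<forall>i<n. \<bar>x i\<bar> \<le> R"
    "\<And>i. \<exists>M. \<forall>x y y'. \<bar>u (x(i := y)) - u (x(i := y'))\<bar> \<le> M * \<bar>y - y'\<bar>"
    "u \<in> borel_measurable borel"
proof -
  obtain n where n: "u \<in> C0_infinity n" using assms by (auto simp: FC_def)
  obtain R where R: "\<And>x. u x \<noteq> 0 \<Longrightarrow> \<forall>i<n. \<bar>x i\<bar> \<le> R" using C0_infinityD(3)[OF n] by blast
  have cont: "continuous_on UNIV u" using C0_infinityD(2)[OF n, of 0] by simp
  obtain B where B: "\<And>x. \<bar>u x\<bar> \<le> B"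
    using bounded_if_compact_support[OF C0_infinityD(1)[OF n] cont R] by blast
  show thesis
    by (rule that[OF C0_infinityD(1)[OF n] B R C0_infinity_lipschitz[OF n] borel_measurable_continuous_onI[OF cont]])
qed

section \<open>Pointwise bounds for the integrand\<close>

lemma inner_integrand_eq:
  "inner_integrand \<alpha> i u v x y =
     (if y = x i then 0 else (u (x(i := y)) - u x) * (v (x(i := y)) - v x) / \<bar>y - x i\<bar> powr (\<alpha> + 1))"
  by (simp add: inner_integrand_def Phi_def)

lemma inner_integrand_nonneg: "0 \<le> inner_integrand \<alpha> i u u x y"
  by (simp add: inner_integrand_eq)

text \<open>From \<open>(\<bar>a\<bar> - \<bar>b\<bar>)\<^sup>2 \<ge> 0\<close>. Convergence of the
  mixed form is thereby reduced to the two diagonal ones.\<close>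

lemma inner_integrand_abs_le:
  "\<bar>inner_integrand \<alpha> i u v x y\<bar> \<le> inner_integrand \<alpha> i u u x y + inner_integrand \<alpha> i v v x y"
proof -
  have "\<bar>a * b\<bar> \<le> a * a + b * b" for a b :: real
  proof -
    have "0 \<le> (\<bar>a\<bar> - \<bar>b\<bar>)\<^sup>2" "0 \<le> \<bar>a\<bar> * \<bar>b\<bar>" by simp_all
    moreover have "(\<bar>a\<bar> - \<bar>b\<bar>)\<^sup>2 = a * a + b * b - 2 * (\<bar>a\<bar> * \<bar>b\<bar>)"
      by (simp add: power2_eq_square algebra_simps)
    ultimately show ?thesis unfolding abs_mult by linarith
  qed
  then show ?thesis
    by (auto simp: inner_integrand_eq add_divide_distrib[symmetric] intro!: divide_right_mono)
qed

text \<open>From \<open>(a + b)\<^sup>2 \<ge> 0\<close>. It carries finiteness over to the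
  differences occurring in closability, which may lie outside \<open>FC\<close>.\<close>

lemma inner_integrand_diff_le:
  "inner_integrand \<alpha> i (\<lambda>x. u x - v x) (\<lambda>x. u x - v x) x y
     \<le> 2 * inner_integrand \<alpha> i u u x y + 2 * inner_integrand \<alpha> i v v x y"
proof -
  have "(a - b) * (a - b) \<le> 2 * (a * a) + 2 * (b * b)" for a b :: real
    using sum_squares_ge_zero[of "a + b" 0] by (simp add: algebra_simps)
  from this[of "u (x(i := y)) - u x" "v (x(i := y)) - v x"] show ?thesis
    by (auto simp: inner_integrand_eq add_divide_distrib[symmetric] algebra_simps intro!: divide_right_mono)
qed

lemma inner_integrand_independent:
  assumes "depends_on_first n u" "n \<le> i"
  shows "inner_integrand \<alpha> i u v x y = 0"
proof -
  have "u (x(i := y)) = u x"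
    using assms unfolding depends_on_first_def by (elim allE impE) auto
  then show ?thesis by (simp add: inner_integrand_eq)
qed

lemma inner_integrand_lipschitz:
  assumes "\<And>y y'. \<bar>u (x(i := y)) - u (x(i := y'))\<bar> \<le> M * \<bar>y - y'\<bar>"
  shows "inner_integrand \<alpha> i u u x y \<le> M\<^sup>2 * \<bar>y - x i\<bar> powr (1 - \<alpha>)"
proof (cases "y = x i")
  case False
  then have t: "0 < \<bar>y - x i\<bar>" by simp
  have "(u (x(i := y)) - u x)\<^sup>2 \<le> (M * \<bar>y - x i\<bar>)\<^sup>2"
    using assms[of y "x i"] by (intro abs_le_square_iff[THEN iffD1]) simp
  then have "inner_integrand \<alpha> i u u x y \<le> (M * \<bar>y - x i\<bar>)\<^sup>2 / \<bar>y - x i\<bar> powr (\<alpha> + 1)"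
    using False by (auto simp: inner_integrand_eq power2_eq_square intro!: divide_right_mono)
  also have "\<dots> = M\<^sup>2 * (\<bar>y - x i\<bar> powr 2 / \<bar>y - x i\<bar> powr (\<alpha> + 1))"
    using t by (simp add: power_mult_distrib)
  also have "\<bar>y - x i\<bar> powr 2 / \<bar>y - x i\<bar> powr (\<alpha> + 1) = \<bar>y - x i\<bar> powr (1 - \<alpha>)"
    by (simp only: powr_diff[symmetric]) simp
  finally show ?thesis .
qed (simp add: inner_integrand_eq)

text \<open>The Lipschitz bound grows at infinity when \<open>\<alpha> < 1\<close>. At distance at
  least 1 the kernel is at most 1, and the increment of \<open>u\<close> is at most
  \<open>2 * B\<close>.\<close>

lemma inner_integrand_bounded:
  assumes "\<And>x. \<bar>u x\<bar> \<le> B" "1 \<le> \<bar>y - x i\<bar>" "0 < \<alpha>"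
  shows "inner_integrand \<alpha> i u u x y \<le> 4 * B\<^sup>2"
proof -
  have "\<bar>u (x(i := y)) - u x\<bar> \<le> \<bar>2 * B\<bar>" using assms(1)[of "x(i := y)"] assms(1)[of x] by linarith
  then have sq: "(u (x(i := y)) - u x)\<^sup>2 \<le> (2 * B)\<^sup>2" by (rule abs_le_square_iff[THEN iffD1])
  have "1 \<le> \<bar>y - x i\<bar> powr (\<alpha> + 1)" using assms by (intro ge_one_powr_ge_zero) auto
  then have "(u (x(i := y)) - u x)\<^sup>2 / \<bar>y - x i\<bar> powr (\<alpha> + 1) \<le> (u (x(i := y)) - u x)\<^sup>2"
    by (simp add: divide_le_eq mult_le_cancel_left1)
  with sq have "(u (x(i := y)) - u x)\<^sup>2 / \<bar>y - x i\<bar> powr (\<alpha> + 1) \<le> 4 * B\<^sup>2"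
    by (simp add: power_mult_distrib)
  then show ?thesis by (auto simp: inner_integrand_eq power2_eq_square)
qed

text \<open>The singularity \<open>s powr (1 - \<alpha>)\<close> is integrable at 0 because \<open>\<alpha> < 2\<close>.\<close>

lemma nn_integral_singularity:
  assumes "\<alpha> < 2"
  shows "(\<integral>\<^sup>+s. ennreal (indicator {0..1} s * s powr (1 - \<alpha>)) \<partial>lborel) = ennreal (1 / (2 - \<alpha>))"
proof (rule nn_integral_has_integral_lborel)
  have "((\<lambda>s. s powr (1 - \<alpha>)) has_integral (1 powr (1 - \<alpha> + 1) / (1 - \<alpha> + 1))) {0..1::real}"
    using assms by (intro has_integral_powr_from_0) auto
  then have "((\<lambda>s. if s \<in> {0..1} then s powr (1 - \<alpha>) else 0) has_integral (1 / (2 - \<alpha>))) UNIV"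
    by (subst has_integral_restrict_UNIV) (simp add: algebra_simps)
  moreover have "(\<lambda>s::real. if s \<in> {0..1} then s powr (1 - \<alpha>) else 0) = (\<lambda>s. indicator {0..1} s * s powr (1 - \<alpha>))"
    by (auto simp: indicator_def)
  ultimately show "((\<lambda>s. indicator {0..1} s * s powr (1 - \<alpha>)) has_integral (1 / (2 - \<alpha>))) UNIV" by simp
qed auto

section \<open>Energies as nonnegative integrals\<close>

locale nonlocal_form = conditional_system +
  fixes \<alpha> :: real
  assumes alpha: "0 < \<alpha>" "\<alpha> < 2"
    and density: "1 < \<alpha> \<Longrightarrow> locally_bounded_density S \<mu> i (\<kappa> i)"
begin

text \<open>Nonnegative integrals stay meaningful when they diverge and are the setting of Fatou's
  lemma.\<close>

definition inner_energy :: "nat \<Rightarrow> (seq \<Rightarrow> real) \<Rightarrow> seq \<Rightarrow> ennreal" where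
  "inner_energy i u x = (\<integral>\<^sup>+y. ennreal (inner_integrand \<alpha> i u u x y) \<partial>\<kappa> i x)"

definition energy :: "nat \<Rightarrow> (seq \<Rightarrow> real) \<Rightarrow> ennreal" where
  "energy i u = (\<integral>\<^sup>+x. inner_energy i u x \<partial>\<mu>)"

lemma inner_integrand_measurable:
  assumes u: "u \<in> borel_measurable borel" and v: "v \<in> borel_measurable borel"
  shows "(\<lambda>(x, y). inner_integrand \<alpha> i u v x y) \<in> borel_measurable (\<mu> \<Otimes>\<^sub>M borel)"
proof -
  have 1: "(\<lambda>p. f ((fst p)(i := snd p))) \<in> borel_measurable (\<mu> \<Otimes>\<^sub>M borel)"
    if "f \<in> borel_measurable borel" for f :: "seq \<Rightarrow> real"
    using measurable_compose[OF update_measurable that] by (simp add: case_prod_unfold)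
  have 2: "(\<lambda>p. f (fst p)) \<in> borel_measurable (\<mu> \<Otimes>\<^sub>M (borel :: real measure))"
    if "f \<in> borel_measurable borel" for f :: "seq \<Rightarrow> real"
    by (rule measurable_compose[OF measurable_fst measurable_compose[OF id_measurable_borel that]])
  have 3: "(\<lambda>p. fst p i) \<in> borel_measurable (\<mu> \<Otimes>\<^sub>M (borel :: real measure))"
    by (rule measurable_compose[OF measurable_fst coordinate_measurable])
  note [measurable] = 1[OF u] 1[OF v] 2[OF u] 2[OF v] 3
  show ?thesis unfolding inner_integrand_eq case_prod_unfold by measurable
qed

lemma section_measurable:
  assumes f: "(\<lambda>(x, y). f x y) \<in> borel_measurable (\<mu> \<Otimes>\<^sub>M borel)" and x: "x \<in> S"
  shows "f x \<in> borel_measurable (\<kappa> i x)"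
proof -
  have "(\<lambda>y. (x, y)) \<in> measurable borel (\<mu> \<Otimes>\<^sub>M borel)" using x by simp
  from measurable_compose[OF this f] have "f x \<in> borel_measurable borel" by simp
  then show ?thesis by (simp add: measurable_cong_sets[OF kernel_props(2)[OF x] refl])
qed

text \<open>This concerns the Bochner integral in \<open>form_i\<close>. Pushing
  \<open>\<kappa> i x\<close> forward by the map sending \<open>y\<close> to \<open>(x, y)\<close>
  replaces the varying integrand by one fixed function on the product, integrated against a measure
  that depends measurably on \<open>x\<close>.\<close>

lemma kernel_integral_measurable:
  fixes f :: "seq \<Rightarrow> real \<Rightarrow> real"
  assumes f: "(\<lambda>(x, y). f x y) \<in> borel_measurable (\<mu> \<Otimes>\<^sub>M borel)"
  shows "(\<lambda>x. \<integral>y. f x y \<partial>\<kappa> i x) \<in> borel_measurable \<mu>"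
proof -
  let ?N = "\<mu> \<Otimes>\<^sub>M (borel :: real measure)"
  have "(\<lambda>x. distr (\<kappa> i x) ?N (\<lambda>y. (x, y))) \<in> measurable \<mu> (subprob_algebra ?N)"
    by (rule measurable_distr2[OF _ kernel_measurable_subprob]) (simp add: case_prod_unfold)
  from measurable_compose[OF this integral_measurable_subprob_algebra[OF f]]
  have "(\<lambda>x. integral\<^sup>L (distr (\<kappa> i x) ?N (\<lambda>y. (x, y))) (\<lambda>(x, y). f x y)) \<in> borel_measurable \<mu>" .
  moreover have "integral\<^sup>L (distr (\<kappa> i x) ?N (\<lambda>y. (x, y))) (\<lambda>(x, y). f x y) = (\<integral>y. f x y \<partial>\<kappa> i x)"
    if x: "x \<in> space \<mu>" for x
  proof -
    have "(\<lambda>y. (x, y)) \<in> measurable (\<kappa> i x) ?N"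
      using x by (simp add: measurable_cong_sets[OF kernel_props(2) refl])
    from integral_distr[OF this f] show ?thesis by simp
  qed
  ultimately show ?thesis by (subst (asm) measurable_cong) auto
qed

lemma inner_energy_measurable:
  assumes "u \<in> borel_measurable borel"
  shows "inner_energy i u \<in> borel_measurable \<mu>"
proof -
  have "(\<lambda>(x, y). ennreal (inner_integrand \<alpha> i u u x y)) \<in> borel_measurable (\<mu> \<Otimes>\<^sub>M borel)"
    using inner_integrand_measurable[OF assms assms] by (simp add: case_prod_unfold)
  from nn_integral_measurable_subprob_algebra2[OF this kernel_measurable_subprob]
  show ?thesis by (simp add: inner_energy_def[abs_def])
qed

text \<open>The almost sure bound on the inner integral is stronger than a finite energy; it is what
  the estimates deliver, and on a probability space it yields integrability at once. The constant
  may vary with \<open>i\<close> because finite dependence leaves only finitely many nonzero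
  energies.\<close>

definition finite_energy :: "(seq \<Rightarrow> real) \<Rightarrow> bool" where
  "finite_energy u \<longleftrightarrow> u \<in> borel_measurable borel \<and> (\<exists>n. depends_on_first n u) \<and>
     (\<forall>i. \<exists>C::real. AE x in \<mu>. inner_energy i u x \<le> ennreal C)"

text \<open>Coordinates from \<open>n\<close> on contribute 0. For \<open>\<alpha> \<le> 1\<close>
  the integrand is bounded and the kernel has mass 1. For \<open>1 < \<alpha>\<close> the Lipschitz
  bound is singular on the diagonal, and the density is used to integrate it.\<close>

lemma inner_energy_bounded_FC:
  assumes u: "u \<in> FC"
  shows "\<exists>C::real. AE x in \<mu>. inner_energy i u x \<le> ennreal C"
proof -
  obtain n B R where dep: "depends_on_first n u" and B: "\<And>x. \<bar>u x\<bar> \<le> B"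
    and R: "\<And>x. u x \<noteq> 0 \<Longrightarrow> \<forall>i<n. \<bar>x i\<bar> \<le> R"
    and lip: "\<And>i. \<exists>M. \<forall>x y y'. \<bar>u (x(i := y)) - u (x(i := y'))\<bar> \<le> M * \<bar>y - y'\<bar>"
    and meas: "u \<in> borel_measurable borel"
    using FC_props[OF u] by blast
  obtain M where M: "\<And>x y y'. \<bar>u (x(i := y)) - u (x(i := y'))\<bar> \<le> M * \<bar>y - y'\<bar>" using lip[of i] by blast
  consider "n \<le> i" | "\<alpha> \<le> 1" | "i < n" "1 < \<alpha>" by linarith
  then show ?thesis
  proof cases
    case 1
    then show ?thesis by (intro exI[of _ 0]) (simp add: inner_energy_def inner_integrand_independent[OF dep])
  next
    case 2
    have bound: "inner_integrand \<alpha> i u u x y \<le> M\<^sup>2 + 4 * B\<^sup>2" for x y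
    proof (cases "1 \<le> \<bar>y - x i\<bar>")
      case True
      show ?thesis using inner_integrand_bounded[of u B y x i \<alpha>, OF B True alpha(1)] zero_le_power2[of M] by linarith
    next
      case False
      have "\<bar>y - x i\<bar> powr (1 - \<alpha>) \<le> 1" using False 2 by (intro powr_le1) auto
      then have "M\<^sup>2 * \<bar>y - x i\<bar> powr (1 - \<alpha>) \<le> M\<^sup>2" by (simp add: mult_left_le)
      then show ?thesis using inner_integrand_lipschitz[of u x i M \<alpha> y, OF M] zero_le_power2[of B] by linarith
    qed
    have "inner_energy i u x \<le> ennreal (M\<^sup>2 + 4 * B\<^sup>2)" if x: "x \<in> space \<mu>" for x
    proof -
      interpret K: prob_space "\<kappa> i x" using kernel_props(1) x by simp
      have "inner_energy i u x \<le> (\<integral>\<^sup>+y. ennreal (M\<^sup>2 + 4 * B\<^sup>2) \<partial>\<kappa> i x)"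
        unfolding inner_energy_def by (intro nn_integral_mono ennreal_leI bound)
      then show ?thesis by (simp add: K.emeasure_space_1)
    qed
    then show ?thesis by (auto intro!: exI[of _ "M\<^sup>2 + 4 * B\<^sup>2"] AE_I2)
  next
    case 3
    \<comment> \<open>If \<open>y\<close> lies outside \<open>?K\<close> and within distance 1 of
      \<open>x i\<close>, then both \<open>y\<close> and \<open>x i\<close> have modulus above
      \<open>R\<close> and \<open>u\<close> vanishes at both points. One compact set thus works for
      all \<open>x\<close>.\<close>
    let ?K = "{- (R + 1)..R + 1}"
    let ?g = "\<lambda>s. ennreal (indicator {0..1} s * s powr (1 - \<alpha>))"
    obtain \<rho> L where rho0: "\<And>x y. x \<in> S \<Longrightarrow> 0 \<le> \<rho> x y"
      and rhom: "\<And>x. x \<in> S \<Longrightarrow> \<rho> x \<in> borel_measurable borel"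
      and ae1: "AE x in \<mu>. \<kappa> i x = density lborel (\<lambda>y. ennreal (\<rho> x y))"
      and ae2: "AE x in \<mu>. esssup (restrict_space lborel ?K) (\<lambda>y. ereal (\<rho> x y)) \<le> ereal L"
    proof -
      from density[OF 3(2), of i] obtain \<rho> :: "seq \<Rightarrow> real \<Rightarrow> real" where
        "\<forall>x\<in>S. \<forall>y. 0 \<le> \<rho> x y" "\<forall>x\<in>S. \<rho> x \<in> borel_measurable borel"
        "AE x in \<mu>. \<kappa> i x = density lborel (\<lambda>y. ennreal (\<rho> x y))"
        "\<forall>K. compact K \<longrightarrow> (\<exists>L::real. AE x in \<mu>. esssup (restrict_space lborel K) (\<lambda>y. ereal (\<rho> x y)) \<le> ereal L)"
        unfolding locally_bounded_density_def by (elim exE conjE)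
      moreover from this(4) obtain L :: real
        where "AE x in \<mu>. esssup (restrict_space lborel ?K) (\<lambda>y. ereal (\<rho> x y)) \<le> ereal L"
        using compact_Icc by blast
      ultimately show ?thesis by (intro that) auto
    qed
    define L' where "L' = max L 0"
    \<comment> \<open>Near the diagonal each side contributes
      \<open>L' * M\<^sup>2 / (2 - \<alpha>)\<close>; at distance at least 1 the bound
      \<open>4 * B\<^sup>2\<close> is integrated against mass 1.\<close>
    define C where "C = 2 * (L' * M\<^sup>2) * (1 / (2 - \<alpha>)) + 4 * B\<^sup>2"
    have key: "inner_energy i u x \<le> ennreal C"
      if x: "x \<in> space \<mu>" and k: "\<kappa> i x = density lborel (\<lambda>y. ennreal (\<rho> x y))"
        and e: "esssup (restrict_space lborel ?K) (\<lambda>y. ereal (\<rho> x y)) \<le> ereal L" for x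
    proof -
      have xS: "x \<in> S" using x by simp
      interpret K: prob_space "\<kappa> i x" by (rule kernel_props(1)[OF xS])
      note [measurable] = rhom[OF xS]
      have sec: "inner_integrand \<alpha> i u u x \<in> borel_measurable borel"
        using section_measurable[OF inner_integrand_measurable[OF meas meas] xS]
        by (simp add: measurable_cong_sets[OF kernel_props(2)[OF xS] refl])
      note [measurable] = sec
      have rL: "AE y in lborel. y \<in> ?K \<longrightarrow> \<rho> x y \<le> L'"
      proof -
        have "AE y in restrict_space lborel ?K. ereal (\<rho> x y) \<le> ereal L"
          using esssup_AE[of "\<lambda>y. ereal (\<rho> x y)" "restrict_space lborel ?K"]
          by (rule eventually_mono) (rule order_trans[OF _ e])
        then have "AE y in lborel. y \<in> ?K \<longrightarrow> ereal (\<rho> x y) \<le> ereal L"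
          by (subst (asm) AE_restrict_space_iff) auto
        then show ?thesis by (rule eventually_mono) (auto simp: L'_def)
      qed
      have pt: "ennreal (\<rho> x y) * ennreal (inner_integrand \<alpha> i u u x y) \<le>
          ennreal (L' * M\<^sup>2) * ?g (y - x i) + ennreal (L' * M\<^sup>2) * ?g (x i - y) + ennreal (4 * B\<^sup>2) * ennreal (\<rho> x y)"
        if y: "y \<in> ?K \<longrightarrow> \<rho> x y \<le> L'" for y
      proof -
        have r0: "0 \<le> \<rho> x y" by (rule rho0[OF xS])
        consider "1 \<le> \<bar>y - x i\<bar>" | "\<bar>y - x i\<bar> < 1" "y \<in> ?K" | "\<bar>y - x i\<bar> < 1" "y \<notin> ?K" by linarith
        then show ?thesis
        proof cases
          case 1
          have "ennreal (\<rho> x y) * ennreal (inner_integrand \<alpha> i u u x y) \<le> ennreal (\<rho> x y) * ennreal (4 * B\<^sup>2)"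
            using inner_integrand_bounded[of u B y x i \<alpha>, OF B 1 alpha(1)] by (intro mult_left_mono ennreal_leI) auto
          then show ?thesis by (simp add: mult.commute add_increasing)
        next
          case 2
          have "\<rho> x y * inner_integrand \<alpha> i u u x y \<le> L' * (M\<^sup>2 * \<bar>y - x i\<bar> powr (1 - \<alpha>))"
            using y 2 r0 inner_integrand_nonneg by (intro mult_mono inner_integrand_lipschitz M) (auto simp: L'_def)
          \<comment> \<open>The power of the distance is split into its right and left halves, so
            that \<open>nn_integral_singularity\<close> applies to each after a translation or a
            reflection.\<close>
          also have "\<dots> \<le> L' * M\<^sup>2 * (indicator {0..1} (y - x i) * (y - x i) powr (1 - \<alpha>)
              + indicator {0..1} (x i - y) * (x i - y) powr (1 - \<alpha>))"
            unfolding mult.assoc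
          proof (intro mult_left_mono)
            have "y - x i \<le> 1" "x i - y \<le> 1" using 2 by linarith+
            then show "\<bar>y - x i\<bar> powr (1 - \<alpha>) \<le> indicator {0..1} (y - x i) * (y - x i) powr (1 - \<alpha>)
              + indicator {0..1} (x i - y) * (x i - y) powr (1 - \<alpha>)"
              by (cases "x i \<le> y") (auto simp: indicator_def)
          qed (auto simp: L'_def)
          finally have "ennreal (\<rho> x y * inner_integrand \<alpha> i u u x y) \<le> ennreal (L' * M\<^sup>2) * ?g (y - x i) + ennreal (L' * M\<^sup>2) * ?g (x i - y)"
            by (simp add: ennreal_mult'[symmetric] ennreal_plus[symmetric] distrib_left ennreal_leI L'_def del: ennreal_plus)
          then show ?thesis using r0 by (simp add: ennreal_mult'[symmetric] add_increasing2)
        next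
          case 3
          have "u (x(i := y)) = 0" using R[of "x(i := y)"] \<open>i < n\<close> 3 by force
          moreover have "u x = 0" using R[of x] \<open>i < n\<close> 3 by force
          ultimately show ?thesis by (simp add: inner_integrand_eq)
        qed
      qed
      have g1: "(\<integral>\<^sup>+y. ?g (y - x i) \<partial>lborel) = ennreal (1 / (2 - \<alpha>))"
        using nn_integral_real_affine[of ?g 1 "- x i"] nn_integral_singularity[OF alpha(2)] by simp
      have g2: "(\<integral>\<^sup>+y. ?g (x i - y) \<partial>lborel) = ennreal (1 / (2 - \<alpha>))"
        using nn_integral_real_affine[of ?g "-1" "x i"] nn_integral_singularity[OF alpha(2)] by simp
      have mass: "(\<integral>\<^sup>+y. ennreal (\<rho> x y) \<partial>lborel) = 1"
        using K.emeasure_space_1 unfolding k by (simp add: emeasure_density)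
      have "inner_energy i u x = (\<integral>\<^sup>+y. ennreal (\<rho> x y) * ennreal (inner_integrand \<alpha> i u u x y) \<partial>lborel)"
        unfolding inner_energy_def k using sec rhom[OF xS] by (intro nn_integral_density) simp_all
      also have "\<dots> \<le> (\<integral>\<^sup>+y. ennreal (L' * M\<^sup>2) * ?g (y - x i) + ennreal (L' * M\<^sup>2) * ?g (x i - y) + ennreal (4 * B\<^sup>2) * ennreal (\<rho> x y) \<partial>lborel)"
        by (rule nn_integral_mono_AE) (use rL pt in \<open>auto elim!: eventually_mono\<close>)
      also have "\<dots> = ennreal (L' * M\<^sup>2) * ennreal (1 / (2 - \<alpha>)) + ennreal (L' * M\<^sup>2) * ennreal (1 / (2 - \<alpha>)) + ennreal (4 * B\<^sup>2)"
        by (simp add: nn_integral_add nn_integral_cmult g1 g2 mass del: ennreal_plus)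
      also have "\<dots> = ennreal C"
        using alpha unfolding C_def
        by (simp add: ennreal_mult'[symmetric] ennreal_plus[symmetric] L'_def del: ennreal_plus)
      finally show ?thesis .
    qed
    have "AE x in \<mu>. inner_energy i u x \<le> ennreal C"
      using AE_space[of \<mu>] ae1 ae2 by eventually_elim (rule key)
    then show ?thesis by blast
  qed
qed

lemma finite_energy_FC: "u \<in> FC \<Longrightarrow> finite_energy u"
  unfolding finite_energy_def using inner_energy_bounded_FC FC_props by metis

lemma finite_energy_diff:
  assumes u: "finite_energy u" and v: "finite_energy v"
  shows "finite_energy (\<lambda>x. u x - v x)"
proof -
  have mu: "u \<in> borel_measurable borel" and mv: "v \<in> borel_measurable borel"
    using u v by (auto simp: finite_energy_def)
  obtain m n where "depends_on_first m u" "depends_on_first n v"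
    using u v unfolding finite_energy_def by blast
  then have dep: "depends_on_first (max m n) (\<lambda>x. u x - v x)"
    unfolding depends_on_first_def by (metis less_max_iff_disj)
  have "\<exists>C::real. AE x in \<mu>. inner_energy i (\<lambda>x. u x - v x) x \<le> ennreal C" for i
  proof -
    obtain C D :: real where C: "AE x in \<mu>. inner_energy i u x \<le> ennreal C"
      and D: "AE x in \<mu>. inner_energy i v x \<le> ennreal D"
      using u v unfolding finite_energy_def by blast
    have le: "inner_energy i (\<lambda>x. u x - v x) x \<le> 2 * inner_energy i u x + 2 * inner_energy i v x"
      if x: "x \<in> S" for x
    proof -
      have "inner_energy i (\<lambda>x. u x - v x) x \<le>
          (\<integral>\<^sup>+y. 2 * ennreal (inner_integrand \<alpha> i u u x y) + 2 * ennreal (inner_integrand \<alpha> i v v x y) \<partial>\<kappa> i x)"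
        unfolding inner_energy_def
      proof (rule nn_integral_mono)
        fix y
        have "ennreal (inner_integrand \<alpha> i (\<lambda>x. u x - v x) (\<lambda>x. u x - v x) x y) \<le>
          ennreal (2 * inner_integrand \<alpha> i u u x y + 2 * inner_integrand \<alpha> i v v x y)"
          by (intro ennreal_leI inner_integrand_diff_le)
        also have "\<dots> = 2 * ennreal (inner_integrand \<alpha> i u u x y) + 2 * ennreal (inner_integrand \<alpha> i v v x y)"
          by (simp add: inner_integrand_nonneg ennreal_mult)
        finally show "ennreal (inner_integrand \<alpha> i (\<lambda>x. u x - v x) (\<lambda>x. u x - v x) x y) \<le>
          2 * ennreal (inner_integrand \<alpha> i u u x y) + 2 * ennreal (inner_integrand \<alpha> i v v x y)" .
      qed
      also have "\<dots> = 2 * inner_energy i u x + 2 * inner_energy i v x"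
        unfolding inner_energy_def
        using section_measurable[OF inner_integrand_measurable[OF mu mu] x, of i i]
          section_measurable[OF inner_integrand_measurable[OF mv mv] x, of i i]
        by (simp add: nn_integral_add nn_integral_cmult)
      finally show ?thesis .
    qed
    \<comment> \<open>\<open>ennreal\<close> sends negative reals to 0, so taking \<open>max\<close>
      with 0 keeps the bounds and makes \<open>ennreal\<close> additive on them.\<close>
    have "AE x in \<mu>. inner_energy i (\<lambda>x. u x - v x) x \<le> ennreal (2 * max C 0 + 2 * max D 0)"
      using C D AE_space[of \<mu>]
    proof eventually_elim
      case (elim x)
      have "inner_energy i u x \<le> ennreal (max C 0)" "inner_energy i v x \<le> ennreal (max D 0)"
        using elim by (auto intro: order_trans ennreal_leI)
      then have "2 * inner_energy i u x + 2 * inner_energy i v x \<le> 2 * ennreal (max C 0) + 2 * ennreal (max D 0)"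
        by (intro add_mono mult_left_mono) auto
      also have "\<dots> = ennreal (2 * max C 0 + 2 * max D 0)" by (simp add: ennreal_mult)
      finally show ?case using le[of x] elim by (auto intro: order_trans)
    qed
    then show ?thesis by blast
  qed
  then show ?thesis using dep mu mv unfolding finite_energy_def by auto
qed

text \<open>The inner integrals of the absolute value are almost surely bounded, which gives
  integrability under the kernels and a bounded outer integrand on a probability space. The series
  is finite because \<open>u\<close> already annihilates all terms from \<open>n\<close> on.\<close>

lemma finite_energy_form_exists:
  assumes u: "finite_energy u" and v: "finite_energy v"
  shows "form_exists \<alpha> \<mu> \<kappa> u v"
proof -
  have mu: "u \<in> borel_measurable borel" and mv: "v \<in> borel_measurable borel"
    using u v by (auto simp: finite_energy_def)
  obtain n where n: "depends_on_first n u" using u unfolding finite_energy_def by blast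
  have "(AE x in \<mu>. integrable (\<kappa> i x) (inner_integrand \<alpha> i u v x)) \<and>
      integrable \<mu> (\<lambda>x. \<integral>y. inner_integrand \<alpha> i u v x y \<partial>\<kappa> i x)" for i
  proof -
    obtain C D :: real where C: "AE x in \<mu>. inner_energy i u x \<le> ennreal C"
      and D: "AE x in \<mu>. inner_energy i v x \<le> ennreal D"
      using u v unfolding finite_energy_def by blast
    have le: "(\<integral>\<^sup>+y. norm (inner_integrand \<alpha> i u v x y) \<partial>\<kappa> i x) \<le> inner_energy i u x + inner_energy i v x"
      if x: "x \<in> S" for x
    proof -
      have "(\<integral>\<^sup>+y. norm (inner_integrand \<alpha> i u v x y) \<partial>\<kappa> i x) \<le>
          (\<integral>\<^sup>+y. ennreal (inner_integrand \<alpha> i u u x y) + ennreal (inner_integrand \<alpha> i v v x y) \<partial>\<kappa> i x)"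
        using inner_integrand_abs_le[of \<alpha> i u v x]
        by (intro nn_integral_mono)
           (simp add: inner_integrand_nonneg ennreal_plus[symmetric] ennreal_leI del: ennreal_plus)
      also have "\<dots> = inner_energy i u x + inner_energy i v x"
        unfolding inner_energy_def
        using section_measurable[OF inner_integrand_measurable[OF mu mu] x, of i i]
          section_measurable[OF inner_integrand_measurable[OF mv mv] x, of i i]
        by (simp add: nn_integral_add)
      finally show ?thesis .
    qed
    define E where "E = max C 0 + max D 0"
    have bd: "AE x in \<mu>. x \<in> S \<and> (\<integral>\<^sup>+y. norm (inner_integrand \<alpha> i u v x y) \<partial>\<kappa> i x) \<le> ennreal E"
      using C D AE_space[of \<mu>]
    proof eventually_elim
      case (elim x)
      have "inner_energy i u x \<le> ennreal (max C 0)" "inner_energy i v x \<le> ennreal (max D 0)"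
        using elim by (auto intro: order_trans ennreal_leI)
      then have "inner_energy i u x + inner_energy i v x \<le> ennreal E"
        unfolding E_def by (simp add: add_mono)
      then show ?case using le[of x] elim by (auto intro: order_trans)
    qed
    have int: "integrable (\<kappa> i x) (inner_integrand \<alpha> i u v x)"
      if "x \<in> S" "(\<integral>\<^sup>+y. norm (inner_integrand \<alpha> i u v x y) \<partial>\<kappa> i x) \<le> ennreal E" for x
      using that section_measurable[OF inner_integrand_measurable[OF mu mv] that(1), of i i]
      by (intro integrableI_bounded) (auto simp: le_less_trans[OF _ ennreal_less_top])
    have "AE x in \<mu>. norm (\<integral>y. inner_integrand \<alpha> i u v x y \<partial>\<kappa> i x) \<le> E"
      using bd
    proof eventually_elim
      case (elim x)
      have "ennreal (norm (\<integral>y. inner_integrand \<alpha> i u v x y \<partial>\<kappa> i x)) \<le> ennreal E"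
        using integral_norm_bound_ennreal[OF int] elim by (auto intro: order_trans)
      moreover have "0 \<le> E" by (simp add: E_def)
      ultimately show ?case by simp
    qed
    then have "integrable \<mu> (\<lambda>x. \<integral>y. inner_integrand \<alpha> i u v x y \<partial>\<kappa> i x)"
      by (rule integrable_const_bound) (rule kernel_integral_measurable[OF inner_integrand_measurable[OF mu mv]])
    moreover have "AE x in \<mu>. integrable (\<kappa> i x) (inner_integrand \<alpha> i u v x)"
      using bd by eventually_elim (auto intro: int)
    ultimately show ?thesis by blast
  qed
  moreover have "summable (\<lambda>i. form_i \<alpha> \<mu> (\<kappa> i) i u v)"
  proof (rule summable_finite[of "{..<n}"])
    fix i assume "i \<notin> {..<n}"
    then show "form_i \<alpha> \<mu> (\<kappa> i) i u v = 0" by (simp add: form_i_def inner_integrand_independent[OF n])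
  qed simp
  ultimately show ?thesis unfolding form_exists_def by blast
qed

text \<open>Finiteness excludes the default values of the inner integral, the outer integral and the
  series. The sign is stated separately because \<open>ennreal\<close> would conceal a negative
  value.\<close>

lemma form_eq_energy:
  assumes u: "finite_energy u"
  shows "ennreal (form \<alpha> \<mu> \<kappa> u u) = (\<Sum>i. energy i u)" "0 \<le> form \<alpha> \<mu> \<kappa> u u"
proof -
  note ex = finite_energy_form_exists[OF u u, unfolded form_exists_def]
  have eq: "ennreal (form_i \<alpha> \<mu> (\<kappa> i) i u u) = energy i u" for i
  proof -
    have "energy i u = (\<integral>\<^sup>+x. ennreal (\<integral>y. inner_integrand \<alpha> i u u x y \<partial>\<kappa> i x) \<partial>\<mu>)"
      unfolding energy_def
    proof (rule nn_integral_cong_AE)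
      have "AE x in \<mu>. integrable (\<kappa> i x) (inner_integrand \<alpha> i u u x)" using ex by blast
      then show "AE x in \<mu>. inner_energy i u x = ennreal (\<integral>y. inner_integrand \<alpha> i u u x y \<partial>\<kappa> i x)"
        by eventually_elim (simp add: inner_energy_def nn_integral_eq_integral inner_integrand_nonneg)
    qed
    also have "\<dots> = ennreal (form_i \<alpha> \<mu> (\<kappa> i) i u u)"
      unfolding form_i_def
    proof (rule nn_integral_eq_integral)
      show "integrable \<mu> (\<lambda>x. \<integral>y. inner_integrand \<alpha> i u u x y \<partial>\<kappa> i x)" using ex by blast
    qed (simp add: inner_integrand_nonneg integral_nonneg_AE)
    finally show ?thesis by simp
  qed
  have nn: "0 \<le> form_i \<alpha> \<mu> (\<kappa> i) i u u" for i
    unfolding form_i_def by (intro integral_nonneg_AE AE_I2 inner_integrand_nonneg)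
  have sm: "summable (\<lambda>i. form_i \<alpha> \<mu> (\<kappa> i) i u u)" using ex by blast
  show "ennreal (form \<alpha> \<mu> \<kappa> u u) = (\<Sum>i. energy i u)"
    unfolding form_def suminf_ennreal2[OF nn sm, symmetric] eq ..
  show "0 \<le> form \<alpha> \<mu> \<kappa> u u" unfolding form_def by (rule suminf_nonneg[OF sm nn])
qed

section \<open>Independence of representatives\<close>

lemma form_cong_AE:
  assumes "u \<in> borel_measurable borel" "u' \<in> borel_measurable borel"
      "v \<in> borel_measurable borel" "v' \<in> borel_measurable borel"
    and uu': "AE x in \<mu>. u x = u' x" and vv': "AE x in \<mu>. v x = v' x"
  shows "form \<alpha> \<mu> \<kappa> u v = form \<alpha> \<mu> \<kappa> u' v'"
proof -
  have "form_i \<alpha> \<mu> (\<kappa> i) i u v = form_i \<alpha> \<mu> (\<kappa> i) i u' v'" for i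
    unfolding form_i_def
  proof (rule integral_cong_AE)
    \<comment> \<open>The integrand evaluates the functions at \<open>x\<close> and at
      \<open>x(i := y)\<close>: the hypotheses settle the first point, \<open>AE_update\<close> the
      second.\<close>
    have U: "AE x in \<mu>. AE y in \<kappa> i x. u (x(i := y)) = u' (x(i := y))" using borel_measurable_eq[OF assms(1,2)] by (intro AE_update[OF _ uu']) simp
    have V: "AE x in \<mu>. AE y in \<kappa> i x. v (x(i := y)) = v' (x(i := y))" using borel_measurable_eq[OF assms(3,4)] by (intro AE_update[OF _ vv']) simp
    show "AE x in \<mu>. (\<integral>y. inner_integrand \<alpha> i u v x y \<partial>\<kappa> i x) = (\<integral>y. inner_integrand \<alpha> i u' v' x y \<partial>\<kappa> i x)"
      using uu' vv' U V AE_space[of \<mu>]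
    proof eventually_elim
      case (elim x)
      have "x \<in> S" using elim by simp
      then show ?case
      proof (intro integral_cong_AE section_measurable inner_integrand_measurable assms)
        show "AE y in \<kappa> i x. inner_integrand \<alpha> i u v x y = inner_integrand \<alpha> i u' v' x y"
          using elim(3,4) by eventually_elim (simp add: inner_integrand_eq elim(1,2))
      qed
    qed
  qed (intro kernel_integral_measurable inner_integrand_measurable assms)+
  then show ?thesis by (simp add: form_def)
qed

lemma well_defined: "well_defined_on_FC \<alpha> \<mu> \<kappa>"
  unfolding well_defined_on_FC_def
proof (intro conjI ballI impI)
  have meas: "w \<in> borel_measurable borel" if "w \<in> FC" for w
    using finite_energy_FC[OF that] by (simp add: finite_energy_def)
  show "form \<alpha> \<mu> \<kappa> u u = 0" if "u \<in> FC" "AE x in \<mu>. u x = 0" for u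
  proof -
    have "form \<alpha> \<mu> \<kappa> u u = form \<alpha> \<mu> \<kappa> (\<lambda>_. 0) (\<lambda>_. 0)"
      by (rule form_cong_AE) (use that meas in auto)
    also have "\<dots> = 0" by (simp add: form_def form_i_def inner_integrand_def Phi_def)
    finally show ?thesis .
  qed
  show "form \<alpha> \<mu> \<kappa> u v = form \<alpha> \<mu> \<kappa> u' v'"
    if "u \<in> FC" "u' \<in> FC" "v \<in> FC" "v' \<in> FC" "AE x in \<mu>. u x = u' x" "AE x in \<mu>. v x = v' x" for u u' v v'
    using that by (intro form_cong_AE meas)
  show "form_exists \<alpha> \<mu> \<kappa> u v" if "u \<in> FC" "v \<in> FC" for u v
    using that by (intro finite_energy_form_exists finite_energy_FC)
qed

section \<open>The Markov property\<close>

lemma form_contraction: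
  assumes u: "finite_energy u" and \<phi>u: "finite_energy (\<phi> \<circ> u)"
    and \<phi>: "\<And>s t. \<bar>\<phi> t - \<phi> s\<bar> \<le> \<bar>t - s\<bar>"
  shows "form \<alpha> \<mu> \<kappa> (\<phi> \<circ> u) (\<phi> \<circ> u) \<le> form \<alpha> \<mu> \<kappa> u u"
proof -
  \<comment> \<open>A contraction shrinks every increment and the kernel is nonnegative, so the
    comparison is pointwise. Finiteness of both energies then transfers it to
    \<open>form\<close>.\<close>
  have "inner_integrand \<alpha> i (\<phi> \<circ> u) (\<phi> \<circ> u) x y \<le> inner_integrand \<alpha> i u u x y" for i x y
  proof -
    have "(\<phi> (u (x(i := y))) - \<phi> (u x))\<^sup>2 \<le> (u (x(i := y)) - u x)\<^sup>2"
      by (rule abs_le_square_iff[THEN iffD1]) (rule \<phi>)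
    then show ?thesis by (auto simp: inner_integrand_eq power2_eq_square intro!: divide_right_mono)
  qed
  then have "energy i (\<phi> \<circ> u) \<le> energy i u" for i
    unfolding energy_def inner_energy_def by (intro nn_integral_mono ennreal_leI)
  then have "(\<Sum>i. energy i (\<phi> \<circ> u)) \<le> (\<Sum>i. energy i u)" by (intro suminf_le) auto
  then show ?thesis
    unfolding form_eq_energy(1)[OF u, symmetric] form_eq_energy(1)[OF \<phi>u, symmetric]
    by (simp add: form_eq_energy(2)[OF u])
qed

lemma markovian_form: "markovian (form \<alpha> \<mu> \<kappa>)"
  unfolding markovian_def
proof (intro allI impI)
  fix \<epsilon> :: real assume "0 < \<epsilon>"
  then obtain \<phi> :: "real \<Rightarrow> real" where smooth: "\<And>k. Ck_real k \<phi>" and id: "\<And>t. t \<in> {0..1} \<Longrightarrow> \<phi> t = t"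
    and bd: "\<And>t. - \<epsilon> \<le> \<phi> t \<and> \<phi> t \<le> 1 + \<epsilon>"
    and mono: "\<And>s t. s < t \<Longrightarrow> 0 \<le> \<phi> t - \<phi> s \<and> \<phi> t - \<phi> s \<le> t - s"
    by (rule smooth_truncation) blast
  have contr: "\<bar>\<phi> t - \<phi> s\<bar> \<le> \<bar>t - s\<bar>" for s t
    using mono[of s t] mono[of t s] by (cases s t rule: linorder_cases) auto
  \<comment> \<open>\<open>\<phi> 0 = 0\<close>, needed to keep the support bounded, is the identity
    on the unit interval at \<open>t = 0\<close>.\<close>
  have FC: "\<phi> \<circ> u \<in> FC" if "u \<in> FC" for u using that id[of 0] by (intro FC_compose smooth) auto
  show "\<exists>\<phi> :: real \<Rightarrow> real. (\<forall>t\<in>{0..1}. \<phi> t = t) \<and> (\<forall>t. - \<epsilon> \<le> \<phi> t \<and> \<phi> t \<le> 1 + \<epsilon>) \<and>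
        (\<forall>t t'. t < t' \<longrightarrow> 0 \<le> \<phi> t' - \<phi> t \<and> \<phi> t' - \<phi> t \<le> t' - t) \<and>
        (\<forall>u\<in>FC. \<phi> \<circ> u \<in> FC \<and> form \<alpha> \<mu> \<kappa> (\<phi> \<circ> u) (\<phi> \<circ> u) \<le> form \<alpha> \<mu> \<kappa> u u)"
  proof (intro exI[of _ \<phi>] conjI ballI allI impI)
    fix u assume u: "u \<in> FC"
    show "\<phi> \<circ> u \<in> FC" by (rule FC[OF u])
    show "form \<alpha> \<mu> \<kappa> (\<phi> \<circ> u) (\<phi> \<circ> u) \<le> form \<alpha> \<mu> \<kappa> u u"
      by (intro form_contraction finite_energy_FC u FC contr)
  qed (use id bd mono in auto)
qed

section \<open>Lower semicontinuity and closability\<close>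

lemma energy_le_liminf:
  fixes w :: "nat \<Rightarrow> seq \<Rightarrow> real"
  assumes w: "\<And>k. w k \<in> borel_measurable borel" and u: "u \<in> borel_measurable borel"
    and lim: "AE x in \<mu>. (\<lambda>k. w k x) \<longlonglongrightarrow> u x"
  shows "energy i u \<le> liminf (\<lambda>k. energy i (w k))"
proof -
  note [measurable] = w u
  have lim': "AE x in \<mu>. AE y in \<kappa> i x. (\<lambda>k. w k (x(i := y))) \<longlonglongrightarrow> u (x(i := y))"
    by (rule AE_update[OF _ lim]) measurable
  \<comment> \<open>The integrands converge because \<open>w k\<close> converges at \<open>x\<close>
    and at almost every resampled point. Fatou's lemma is used here under
    \<open>\<kappa> i x\<close> and afterwards under \<open>\<mu>\<close>.\<close>
  have "AE x in \<mu>. inner_energy i u x \<le> liminf (\<lambda>k. inner_energy i (w k) x)"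
    using lim lim' AE_space[of \<mu>]
  proof eventually_elim
    case (elim x)
    have "AE y in \<kappa> i x. ennreal (inner_integrand \<alpha> i u u x y) =
        liminf (\<lambda>k. ennreal (inner_integrand \<alpha> i (w k) (w k) x y))"
      using elim(2)
    proof eventually_elim
      case (elim y)
      have "(\<lambda>k. ennreal (inner_integrand \<alpha> i (w k) (w k) x y)) \<longlonglongrightarrow> ennreal (inner_integrand \<alpha> i u u x y)"
        unfolding inner_integrand_eq
        by (cases "y = x i")
           (use elim \<open>(\<lambda>k. w k x) \<longlonglongrightarrow> u x\<close> in \<open>auto intro!: tendsto_ennrealI tendsto_intros\<close>)
      then show ?case by (simp add: lim_imp_Liminf)
    qed
    then have "inner_energy i u x = (\<integral>\<^sup>+y. liminf (\<lambda>k. ennreal (inner_integrand \<alpha> i (w k) (w k) x y)) \<partial>\<kappa> i x)"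
      unfolding inner_energy_def by (rule nn_integral_cong_AE)
    also have "\<dots> \<le> liminf (\<lambda>k. inner_energy i (w k) x)"
      unfolding inner_energy_def
    proof (rule nn_integral_liminf)
      fix k
      have "inner_integrand \<alpha> i (w k) (w k) x \<in> borel_measurable (\<kappa> i x)"
        by (rule section_measurable[OF inner_integrand_measurable[OF w w]]) (use elim in simp)
      then show "(\<lambda>y. ennreal (inner_integrand \<alpha> i (w k) (w k) x y)) \<in> borel_measurable (\<kappa> i x)" by simp
    qed
    finally show ?case .
  qed
  then have "energy i u \<le> (\<integral>\<^sup>+x. liminf (\<lambda>k. inner_energy i (w k) x) \<partial>\<mu>)"
    unfolding energy_def by (rule nn_integral_mono_AE)
  also have "\<dots> \<le> liminf (\<lambda>k. energy i (w k))"
    unfolding energy_def by (rule nn_integral_liminf) (rule inner_energy_measurable[OF w])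
  finally show ?thesis .
qed

text \<open>The series is an integral against counting measure, so interchanging it with the lower
  limit is a third use of Fatou's lemma.\<close>

lemma total_energy_le_liminf:
  fixes w :: "nat \<Rightarrow> seq \<Rightarrow> real"
  assumes w: "\<And>k. w k \<in> borel_measurable borel" and u: "u \<in> borel_measurable borel"
    and lim: "AE x in \<mu>. (\<lambda>k. w k x) \<longlonglongrightarrow> u x"
  shows "(\<Sum>i. energy i u) \<le> liminf (\<lambda>k. \<Sum>i. energy i (w k))"
proof -
  have "(\<Sum>i. energy i u) \<le> (\<Sum>i. liminf (\<lambda>k. energy i (w k)))"
    by (intro suminf_le energy_le_liminf[OF w u lim]) auto
  also have "\<dots> \<le> liminf (\<lambda>k. \<Sum>i. energy i (w k))"
    using nn_integral_liminf[of "\<lambda>k i. energy i (w k)" "count_space UNIV"]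
    by (simp add: nn_integral_count_space_nat)
  finally show ?thesis .
qed

text \<open>Convergence in L2 is L1 convergence of the squares, which are integrable since each
  \<open>u n\<close> is bounded; an almost surely convergent subsequence of the squares then gives
  one of the functions.\<close>

lemma AE_subseq_of_L2:
  fixes u :: "nat \<Rightarrow> seq \<Rightarrow> real"
  assumes u: "\<And>n. u n \<in> FC" and lim: "(\<lambda>n. sqrt (\<integral>x. (u n x)\<^sup>2 \<partial>\<mu>)) \<longlonglongrightarrow> 0"
  obtains r where "strict_mono r" "AE x in \<mu>. (\<lambda>k. u (r k) x) \<longlonglongrightarrow> 0"
proof -
  have int: "integrable \<mu> (\<lambda>x. (u n x)\<^sup>2)" for n
  proof -
    obtain B where B: "\<And>x. \<bar>u n x\<bar> \<le> B" and m: "u n \<in> borel_measurable borel"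
      using FC_props[OF u[of n]] by metis
    have "(u n x)\<^sup>2 \<le> B\<^sup>2" for x using B[of x] by (intro abs_le_square_iff[THEN iffD1]) linarith
    then show ?thesis
      using measurable_compose[OF id_measurable_borel m]
      by (intro integrable_const_bound[of _ "B\<^sup>2"]) auto
  qed
  have "(\<lambda>n. (sqrt (\<integral>x. (u n x)\<^sup>2 \<partial>\<mu>))\<^sup>2) \<longlonglongrightarrow> 0\<^sup>2" by (rule tendsto_power[OF lim])
  then have "(\<lambda>n. \<integral>x. norm ((u n x)\<^sup>2) \<partial>\<mu>) \<longlonglongrightarrow> 0" by simp
  from tendsto_L1_AE_subseq[OF int this] obtain r where r: "strict_mono r"
    "AE x in \<mu>. (\<lambda>n. (u (r n) x)\<^sup>2) \<longlonglongrightarrow> 0" by blast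
  from r(2) have "AE x in \<mu>. (\<lambda>n. u (r n) x) \<longlonglongrightarrow> 0"
  proof eventually_elim
    case (elim x)
    from tendsto_real_sqrt[OF this] show ?case by (simp add: tendsto_rabs_zero_iff)
  qed
  with r(1) show thesis by (rule that)
qed

lemma closable_form: "closable_L2 \<mu> (form \<alpha> \<mu> \<kappa>)"
  unfolding closable_L2_def
proof (intro allI impI)
  fix u :: "nat \<Rightarrow> seq \<Rightarrow> real"
  assume FC: "\<forall>n. u n \<in> FC" and L2: "(\<lambda>n. sqrt (\<integral>x. (u n x)\<^sup>2 \<partial>\<mu>)) \<longlonglongrightarrow> 0"
    and cauchy: "((\<lambda>(n, m). form \<alpha> \<mu> \<kappa> (\<lambda>x. u n x - u m x) (\<lambda>x. u n x - u m x)) \<longlongrightarrow> 0)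
          (sequentially \<times>\<^sub>F sequentially)"
  have fin: "finite_energy (u n)" for n using FC by (intro finite_energy_FC) auto
  have dfin: "finite_energy (\<lambda>x. u n x - u m x)" for n m by (rule finite_energy_diff[OF fin fin])
  have meas: "u n \<in> borel_measurable borel" "(\<lambda>x. u n x - u m x) \<in> borel_measurable borel" for n m
    using fin[of n] dfin[of n m] by (auto simp: finite_energy_def)
  obtain r where r: "strict_mono r" "AE x in \<mu>. (\<lambda>k. u (r k) x) \<longlonglongrightarrow> 0"
    using AE_subseq_of_L2[OF _ L2] FC by blast
  show "(\<lambda>n. form \<alpha> \<mu> \<kappa> (u n) (u n)) \<longlonglongrightarrow> 0"
  proof (rule LIMSEQ_I)
    fix e :: real assume e: "0 < e"
    have "\<forall>\<^sub>F p in sequentially \<times>\<^sub>F sequentially.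
        (case p of (n, m) \<Rightarrow> form \<alpha> \<mu> \<kappa> (\<lambda>x. u n x - u m x) (\<lambda>x. u n x - u m x)) < e / 2"
      using e by (intro order_tendstoD(2)[OF cauchy]) simp
    then obtain N where N: "\<And>m n. N \<le> m \<Longrightarrow> N \<le> n \<Longrightarrow>
        form \<alpha> \<mu> \<kappa> (\<lambda>x. u n x - u m x) (\<lambda>x. u n x - u m x) < e / 2"
      unfolding eventually_prod_sequentially by auto
    \<comment> \<open>The strict Cauchy bound weakens to \<open>\<le>\<close> in the lower limit;
      \<open>e / 2\<close> restores strictness at the end.\<close>
    have "form \<alpha> \<mu> \<kappa> (u n) (u n) \<le> e / 2" if n: "N \<le> n" for n
    proof -
      have lim: "AE x in \<mu>. (\<lambda>k. u n x - u (r k) x) \<longlonglongrightarrow> u n x"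
        using r(2) by eventually_elim (auto intro!: tendsto_eq_intros)
      have "ennreal (form \<alpha> \<mu> \<kappa> (u n) (u n)) \<le> liminf (\<lambda>k. \<Sum>i. energy i (\<lambda>x. u n x - u (r k) x))"
        unfolding form_eq_energy(1)[OF fin] by (rule total_energy_le_liminf[OF meas(2) meas(1) lim])
      also have "\<dots> \<le> limsup (\<lambda>k. \<Sum>i. energy i (\<lambda>x. u n x - u (r k) x))"
        by (rule Liminf_le_Limsup) simp
      also have "\<dots> \<le> ennreal (e / 2)"
      proof (rule Limsup_bounded)
        have "\<forall>k\<ge>N. (\<Sum>i. energy i (\<lambda>x. u n x - u (r k) x)) \<le> ennreal (e / 2)"
        proof (intro allI impI)
          fix k assume "N \<le> k"
          then have "N \<le> r k" using seq_suble[OF r(1), of k] by linarith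
          then show "(\<Sum>i. energy i (\<lambda>x. u n x - u (r k) x)) \<le> ennreal (e / 2)"
            unfolding form_eq_energy(1)[OF dfin, symmetric] using N[of "r k" n] n by (intro ennreal_leI) simp
        qed
        then show "\<forall>\<^sub>F k in sequentially. (\<Sum>i. energy i (\<lambda>x. u n x - u (r k) x)) \<le> ennreal (e / 2)"
          by (auto simp: eventually_sequentially)
      qed
      finally show ?thesis using e by simp
    qed
    then show "\<exists>N. \<forall>n\<ge>N. norm (form \<alpha> \<mu> \<kappa> (u n) (u n) - 0) < e"
      using e form_eq_energy(2)[OF fin] by (intro exI[of _ N]) force
  qed
qed

end

theorem theorem1:
  fixes S :: "seq set" and d :: "seq \<Rightarrow> seq \<Rightarrow> real"
    and \<mu> :: "seq measure" and \<kappa> :: "nat \<Rightarrow> seq \<Rightarrow> real measure" and \<alpha> :: real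
  assumes "state_space S d"
    and "prob_space \<mu>" and "sets \<mu> = sets (metric_borel S d)"
    and "\<And>i. cond_dist S \<mu> i (\<kappa> i)"
    and "0 < \<alpha>" and "\<alpha> < 2"
    and "1 < \<alpha> \<Longrightarrow> \<forall>i. locally_bounded_density S \<mu> i (\<kappa> i)"
  shows "well_defined_on_FC \<alpha> \<mu> \<kappa> \<and>
    markovian (form \<alpha> \<mu> \<kappa>) \<and>
    closable_L2 \<mu> (form \<alpha> \<mu> \<kappa>)"
proof -
  interpret prob_space \<mu> by fact
  have "space \<mu> = S"
    using sets_eq_imp_space_eq[OF assms(3)] state_space_measurable(1)[OF assms(1)] by simp
  moreover have "(\<lambda>x. x i) \<in> borel_measurable \<mu>" for i
    using state_space_measurable(2)[OF assms(1), of i] by (simp add: measurable_cong_sets[OF assms(3) refl])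
  ultimately interpret nonlocal_form \<mu> S \<kappa> \<alpha>
    using assms(4-7) by unfold_locales auto
  show ?thesis using well_defined markovian_form closable_form by blast
qed

end
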